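(* Let $G$ be a $3$-dimensional non-unimodular Lie group equipped with a left invariant statistical structure $(g,\nabla)$ such that $\nabla\neq\nabla^g$, where $\nabla^g$ is the Levi-Civita connection of $g$. If $(G,g,\nabla)$ is conjugate symmetric, then $G$ is locally isomorphic to a solvable Lie group model $\widetilde{G}(0,\eta)$ (for some $\eta\geq 0$) of the hyperbolic $3$-space, or to the product Lie group $\mathbb{H}^2(-4)\times\mathbb{R}$ of the solvable Lie group model of the hyperbolic plane and the real line.
   Context: A left invariant statistical structure $(g,\nabla)$ on a Lie group $G$ consists of a left invariant Riemannian metric $g$ and a left invariant torsion free linear connection $\nabla$ such that $\nabla g$, $(X,Y,Z)\mapsto(\nabla_Xg)(Y,Z)$, is totally symmetric. The dual connection $\nabla^*$ is defined by $X\,g(Y,Z)=g(\nabla_XY,Z)+g(Y,\nabla^*_XZ)$. A statistical manifold is conjugate symmetric if the curvature tensors of $\nabla$ and $\nabla^*$ coincide. Two Lie groups are locally isomorphic if their Lie algebras are isomorphic. For $\xi,\eta\ge0$, $\widetilde{G}(\xi,\eta)$ denotes the simply connected Lie group whose Lie algebra $\mathfrak{g}(\xi,\eta)$ has a basis $\{e_1,e_2,e_3\}$ with \[ [e_1,e_2]=(1+\xi)(e_2+\eta e_3),\quad [e_2,e_3]=0,\quad [e_3,e_1]=(1-\xi)(\eta e_2-e_3), \] equipped with the left invariant metric making this basis orthonormal. The solvable Lie group models of hyperbolic $3$-space (curvature $-1$) are the groups $\widetilde{G}(0,\eta)$, $\eta\ge0$, whose brackets are $[e_1,e_2]=e_2+\eta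 e_3$, $[e_1,e_3]=-\eta e_2+e_3$, $[e_2,e_3]=0$; each is isometric to $\mathbb{H}^3(-1)$. The product Lie group $\mathbb{H}^2(-4)\times\mathbb{R}$ is $\widetilde{G}(1,0)$, with brackets $[e_1,e_2]=2e_2$, $[e_1,e_3]=[e_2,e_3]=0$; it is isometric to the Riemannian product of the hyperbolic plane of curvature $-4$ and the real line. *)

theory Defs
  imports "HOL-Analysis.Analysis" "HOL-Library.Function_Algebras"
begin

subsection \<open>Functions as a real vector space\<close>

instantiation "fun" :: (type, real_vector) real_vector
begin

definition scaleR_fun :: "real \<Rightarrow> ('a \<Rightarrow> 'b) \<Rightarrow> 'a \<Rightarrow> 'b"
  where "scaleR_fun c f = (\<lambda>x. c *\<^sub>R f x)"

instance
  by standard (auto simp: scaleR_fun_def plus_fun_def fun_eq_iff algebra_simps)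

end

text \<open>
  Trace of an endomorphism \<open>T\<close> of a finite-dimensional subspace \<open>V\<close>; the value does not depend on
  the basis that is chosen.
\<close>

definition lin_trace :: "'v::real_vector set \<Rightarrow> ('v \<Rightarrow> 'v) \<Rightarrow> real"
  where "lin_trace V T =
    (let B = (SOME B. independent B \<and> span B = V) in \<Sum>b\<in>B. representation B (T b) b)"


subsection \<open>Smooth manifolds\<close>

text \<open>
  Functions of class \<open>C\<^sup>k\<close> and \<open>C\<^sup>\<infinity>\<close> on an open set \<open>S\<close>, via iterated directional derivatives.
\<close>

fun Ck_on :: "nat \<Rightarrow> ('a::euclidean_space \<Rightarrow> 'b::euclidean_space) \<Rightarrow> 'a set \<Rightarrow> bool"
  where
    "Ck_on 0 f S \<longleftrightarrow> continuous_on S f"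
  | "Ck_on (Suc k) f S \<longleftrightarrow>
      (\<forall>x\<in>S. f differentiable (at x)) \<and> (\<forall>v. Ck_on k (\<lambda>x. frechet_derivative f (at x) v) S)"

definition smooth_on :: "('a::euclidean_space \<Rightarrow> 'b::euclidean_space) \<Rightarrow> 'a set \<Rightarrow> bool"
  where "smooth_on f S \<longleftrightarrow> (\<forall>k. Ck_on k f S)"

text \<open>A chart is a pair of its open domain and the coordinate map, which is only relevant there.\<close>

type_synonym ('m, 'e) chart = "'m set \<times> ('m \<Rightarrow> 'e)"

definition is_chart :: "('m::topological_space, 'e::euclidean_space) chart \<Rightarrow> bool"
  where "is_chart c \<longleftrightarrow> (case c of (U, \<phi>) \<Rightarrow>
    open U \<and> open (\<phi> ` U) \<and> (\<exists>\<psi>. homeomorphism U (\<phi> ` U) \<phi> \<psi>))"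

definition smooth_atlas ::
    "('m::{t2_space,second_countable_topology}, 'e::euclidean_space) chart set \<Rightarrow> bool"
  where "smooth_atlas A \<longleftrightarrow>
    (\<forall>c\<in>A. is_chart c) \<and> (\<Union>(fst ` A)) = UNIV \<and>
    (\<forall>(U, \<phi>)\<in>A. \<forall>(V, \<psi>)\<in>A. smooth_on (\<psi> \<circ> inv_into U \<phi>) (\<phi> ` (U \<inter> V)))"

definition prod_atlas ::
    "('m, 'e) chart set \<Rightarrow> ('n, 'f) chart set \<Rightarrow> ('m \<times> 'n, 'e \<times> 'f) chart set"
  where "prod_atlas A B = {(U \<times> V, map_prod \<phi> \<psi>) | U \<phi> V \<psi>. (U, \<phi>) \<in> A \<and> (V, \<psi>) \<in> B}"

definition smooth_map ::
    "('m::topological_space, 'e::euclidean_space) chart set \<Rightarrow>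
     ('n::topological_space, 'f::euclidean_space) chart set \<Rightarrow> ('m \<Rightarrow> 'n) \<Rightarrow> bool"
  where "smooth_map A B F \<longleftrightarrow> continuous_on UNIV F \<and>
    (\<forall>(U, \<phi>)\<in>A. \<forall>(V, \<psi>)\<in>B. smooth_on (\<psi> \<circ> F \<circ> inv_into U \<phi>) (\<phi> ` (U \<inter> F -` V)))"

text \<open>Real-valued functions that are smooth on an open subset \<open>W\<close>.\<close>

definition smooth_fun_on ::
    "('m::topological_space, 'e::euclidean_space) chart set \<Rightarrow> 'm set \<Rightarrow> ('m \<Rightarrow> real) \<Rightarrow> bool"
  where "smooth_fun_on A W f \<longleftrightarrow> (\<forall>(U, \<phi>)\<in>A. smooth_on (f \<circ> inv_into U \<phi>) (\<phi> ` (U \<inter> W)))"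

definition smooth_near ::
    "('m::topological_space, 'e::euclidean_space) chart set \<Rightarrow> 'm \<Rightarrow> ('m \<Rightarrow> real) set"
  where "smooth_near A p = {f. \<exists>W. open W \<and> p \<in> W \<and> smooth_fun_on A W f}"


subsection \<open>Tangent vectors and vector fields\<close>

text \<open>
  A tangent vector at \<open>p\<close> is a derivation at \<open>p\<close> of the functions that are smooth near \<open>p\<close>.
  The Leibniz rule forces its value to depend only on the germ of the function: if \<open>f\<close> vanishes
  on an open \<open>W\<close> containing \<open>p\<close>, then \<open>f = f * h\<close>, where \<open>h\<close> is the indicator function of the
  complement of \<open>W\<close>, and \<open>f\<close> and \<open>h\<close> both vanish at \<open>p\<close>. On all other functions a
  tangent vector is \<open>0\<close> by convention, so that tangent vectors are equal iff they agree on germs.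
\<close>

type_synonym 'm tvec = "('m \<Rightarrow> real) \<Rightarrow> real"
type_synonym 'm vfield = "'m \<Rightarrow> 'm tvec"

definition tangent_space ::
    "('m::topological_space, 'e::euclidean_space) chart set \<Rightarrow> 'm \<Rightarrow> 'm tvec set"
  where "tangent_space A p = {v.
    (\<forall>f\<in>smooth_near A p. \<forall>h\<in>smooth_near A p.
        v (f + h) = v f + v h \<and> v (f * h) = f p * v h + h p * v f) \<and>
    (\<forall>c. \<forall>f\<in>smooth_near A p. v (c *\<^sub>R f) = c * v f) \<and>
    (\<forall>f. f \<notin> smooth_near A p \<longrightarrow> v f = 0)}"

definition vapply :: "'m vfield \<Rightarrow> ('m \<Rightarrow> real) \<Rightarrow> 'm \<Rightarrow> real"
  where "vapply X f = (\<lambda>p. X p f)"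

definition vector_fields ::
    "('m::topological_space, 'e::euclidean_space) chart set \<Rightarrow> 'm vfield set"
  where "vector_fields A = {X. (\<forall>p. X p \<in> tangent_space A p) \<and>
    (\<forall>W f. open W \<and> smooth_fun_on A W f \<longrightarrow> smooth_fun_on A W (vapply X f))}"

definition fmult :: "('m \<Rightarrow> real) \<Rightarrow> 'm vfield \<Rightarrow> 'm vfield"
  where "fmult f X = (\<lambda>p. f p *\<^sub>R X p)"

definition lie_bracket ::
    "('m::topological_space, 'e::euclidean_space) chart set \<Rightarrow> 'm vfield \<Rightarrow> 'm vfield \<Rightarrow> 'm vfield"
  where "lie_bracket A X Y = (\<lambda>p f.
    if f \<in> smooth_near A p then X p (vapply Y f) - Y p (vapply X f) else 0)"


subsection \<open>Riemannian metrics and linear connections\<close>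

type_synonym 'm metric = "'m \<Rightarrow> 'm tvec \<Rightarrow> 'm tvec \<Rightarrow> real"
type_synonym 'm connection = "'m vfield \<Rightarrow> 'm vfield \<Rightarrow> 'm vfield"

definition metric_apply :: "'m metric \<Rightarrow> 'm vfield \<Rightarrow> 'm vfield \<Rightarrow> 'm \<Rightarrow> real"
  where "metric_apply g X Y = (\<lambda>p. g p (X p) (Y p))"

definition riemannian_metric ::
    "('m::topological_space, 'e::euclidean_space) chart set \<Rightarrow> 'm metric \<Rightarrow> bool"
  where "riemannian_metric A g \<longleftrightarrow>
    (\<forall>p. \<forall>u\<in>tangent_space A p. \<forall>v\<in>tangent_space A p. g p u v = g p v u) \<and>
    (\<forall>p. \<forall>u\<in>tangent_space A p. \<forall>v\<in>tangent_space A p. \<forall>w\<in>tangent_space A p.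
        g p (u + v) w = g p u w + g p v w) \<and>
    (\<forall>p c. \<forall>u\<in>tangent_space A p. \<forall>v\<in>tangent_space A p. g p (c *\<^sub>R u) v = c * g p u v) \<and>
    (\<forall>p. \<forall>u\<in>tangent_space A p. u \<noteq> 0 \<longrightarrow> g p u u > 0) \<and>
    (\<forall>X\<in>vector_fields A. \<forall>Y\<in>vector_fields A. smooth_fun_on A UNIV (metric_apply g X Y))"

text \<open>
  \<open>D X Y\<close> is the covariant derivative of \<open>Y\<close> along \<open>X\<close>. Connections are \<open>0\<close> off the vector
  fields by convention, so that two connections are equal iff they agree on vector fields.
\<close>

definition linear_connection ::
    "('m::topological_space, 'e::euclidean_space) chart set \<Rightarrow> 'm connection \<Rightarrow> bool"
  where "linear_connection A D \<longleftrightarrow>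
    (\<forall>X\<in>vector_fields A. \<forall>Y\<in>vector_fields A. D X Y \<in> vector_fields A) \<and>
    (\<forall>X Y. X \<notin> vector_fields A \<or> Y \<notin> vector_fields A \<longrightarrow> D X Y = 0) \<and>
    (\<forall>X\<in>vector_fields A. \<forall>X'\<in>vector_fields A. \<forall>Y\<in>vector_fields A.
        D (X + X') Y = D X Y + D X' Y \<and> D Y (X + X') = D Y X + D Y X') \<and>
    (\<forall>f. \<forall>X\<in>vector_fields A. \<forall>Y\<in>vector_fields A. smooth_fun_on A UNIV f \<longrightarrow>
        D (fmult f X) Y = fmult f (D X Y) \<and>
        D X (fmult f Y) = fmult (vapply X f) Y + fmult f (D X Y))"

definition torsion_free ::
    "('m::topological_space, 'e::euclidean_space) chart set \<Rightarrow> 'm connection \<Rightarrow> bool"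
  where "torsion_free A D \<longleftrightarrow>
    (\<forall>X\<in>vector_fields A. \<forall>Y\<in>vector_fields A. D X Y - D Y X = lie_bracket A X Y)"

text \<open>The function \<open>(\<nabla>\<^sub>X g)(Y, Z)\<close>.\<close>

definition nabla_metric ::
    "'m metric \<Rightarrow> 'm connection \<Rightarrow> 'm vfield \<Rightarrow> 'm vfield \<Rightarrow> 'm vfield \<Rightarrow> 'm \<Rightarrow> real"
  where "nabla_metric g D X Y Z =
    vapply X (metric_apply g Y Z) - metric_apply g (D X Y) Z - metric_apply g Y (D X Z)"

definition levi_civita ::
    "('m::topological_space, 'e::euclidean_space) chart set \<Rightarrow> 'm metric \<Rightarrow> 'm connection"
  where "levi_civita A g = (THE D. linear_connection A D \<and> torsion_free A D \<and>
    (\<forall>X\<in>vector_fields A. \<forall>Y\<in>vector_fields A. \<forall>Z\<in>vector_fields A. nabla_metric g D X Y Z = 0))"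

definition dual_connection ::
    "('m::topological_space, 'e::euclidean_space) chart set \<Rightarrow> 'm metric \<Rightarrow> 'm connection \<Rightarrow>
     'm connection"
  where "dual_connection A g D = (THE D'. linear_connection A D' \<and>
    (\<forall>X\<in>vector_fields A. \<forall>Y\<in>vector_fields A. \<forall>Z\<in>vector_fields A.
        vapply X (metric_apply g Y Z) = metric_apply g (D X Y) Z + metric_apply g Y (D' X Z)))"

definition curvature ::
    "('m::topological_space, 'e::euclidean_space) chart set \<Rightarrow> 'm connection \<Rightarrow>
     'm vfield \<Rightarrow> 'm vfield \<Rightarrow> 'm vfield \<Rightarrow> 'm vfield"
  where "curvature A D X Y Z = D X (D Y Z) - D Y (D X Z) - D (lie_bracket A X Y) Z"

definition statistical_structure ::
    "('m::topological_space, 'e::euclidean_space) chart set \<Rightarrow> 'm metric \<Rightarrow> 'm connection \<Rightarrow> bool"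
  where "statistical_structure A g D \<longleftrightarrow>
    riemannian_metric A g \<and> linear_connection A D \<and> torsion_free A D \<and>
    (\<forall>X\<in>vector_fields A. \<forall>Y\<in>vector_fields A. \<forall>Z\<in>vector_fields A.
        nabla_metric g D X Y Z = nabla_metric g D Y X Z \<and>
        nabla_metric g D X Y Z = nabla_metric g D X Z Y)"

definition conjugate_symmetric ::
    "('m::topological_space, 'e::euclidean_space) chart set \<Rightarrow> 'm metric \<Rightarrow> 'm connection \<Rightarrow> bool"
  where "conjugate_symmetric A g D \<longleftrightarrow>
    (\<forall>X\<in>vector_fields A. \<forall>Y\<in>vector_fields A. \<forall>Z\<in>vector_fields A.
        curvature A D X Y Z = curvature A (dual_connection A g D) X Y Z)"


subsection \<open>Lie groups\<close>

text \<open>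
  The group operation is written additively only because the library's class of (not necessarily
  commutative) groups, \<^class>\<open>group_add\<close>, is; nothing is assumed to commute.
  The dimension of the group is that of the Euclidean space \<open>'e\<close> in which the charts take values.
\<close>

definition lie_group ::
    "('g::{group_add,t2_space,second_countable_topology}, 'e::euclidean_space) chart set \<Rightarrow> bool"
  where "lie_group A \<longleftrightarrow> smooth_atlas A \<and>
    smooth_map (prod_atlas A A) A (\<lambda>(x, y). x + y) \<and> smooth_map A A uminus"

text \<open>
  The differential of the left translation \<open>q \<mapsto> a + q\<close>, sending tangent vectors at \<open>p\<close> to
  tangent vectors at \<open>a + p\<close>, and the induced action on vector fields.
\<close>

definition ltrans_tvec :: "'g::group_add \<Rightarrow> 'g tvec \<Rightarrow> 'g tvec"
  where "ltrans_tvec a v = (\<lambda>f. v (\<lambda>q. f (a + q)))"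

definition ltrans_vfield :: "'g::group_add \<Rightarrow> 'g vfield \<Rightarrow> 'g vfield"
  where "ltrans_vfield a X = (\<lambda>p. ltrans_tvec a (X (- a + p)))"

text \<open>The Lie algebra is the space of left invariant vector fields, with \<^const>\<open>lie_bracket\<close>.\<close>

definition lie_algebra ::
    "('g::{group_add,topological_space}, 'e::euclidean_space) chart set \<Rightarrow> 'g vfield set"
  where "lie_algebra A = {X \<in> vector_fields A. \<forall>a. ltrans_vfield a X = X}"

definition left_invariant_metric ::
    "('g::{group_add,topological_space}, 'e::euclidean_space) chart set \<Rightarrow> 'g metric \<Rightarrow> bool"
  where "left_invariant_metric A g \<longleftrightarrow>
    (\<forall>a p. \<forall>u\<in>tangent_space A p. \<forall>v\<in>tangent_space A p.
        g (a + p) (ltrans_tvec a u) (ltrans_tvec a v) = g p u v)"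

definition left_invariant_connection ::
    "('g::{group_add,topological_space}, 'e::euclidean_space) chart set \<Rightarrow> 'g connection \<Rightarrow> bool"
  where "left_invariant_connection A D \<longleftrightarrow>
    (\<forall>a. \<forall>X\<in>vector_fields A. \<forall>Y\<in>vector_fields A.
        ltrans_vfield a (D X Y) = D (ltrans_vfield a X) (ltrans_vfield a Y))"

definition left_invariant_statistical_structure ::
    "('g::{group_add,topological_space}, 'e::euclidean_space) chart set \<Rightarrow>
     'g metric \<Rightarrow> 'g connection \<Rightarrow> bool"
  where "left_invariant_statistical_structure A g D \<longleftrightarrow>
    statistical_structure A g D \<and> left_invariant_metric A g \<and> left_invariant_connection A D"

text \<open>
  Unimodularity is meant in the sense of the Lie algebra: all operators \<open>ad X\<close> are trace-free.
  For connected groups this is equivalent to the bi-invariance of the Haar measure.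
\<close>

definition unimodular ::
    "('g::{group_add,topological_space}, 'e::euclidean_space) chart set \<Rightarrow> bool"
  where "unimodular A \<longleftrightarrow>
    (\<forall>X\<in>lie_algebra A. lin_trace (lie_algebra A) (lie_bracket A X) = 0)"


subsection \<open>Local isomorphism with the model groups\<close>

text \<open>Isomorphism of Lie algebras, each given by an underlying subspace and a bracket on it.\<close>

definition lie_algebras_isomorphic ::
    "'v::real_vector set \<Rightarrow> ('v \<Rightarrow> 'v \<Rightarrow> 'v) \<Rightarrow> 'w::real_vector set \<Rightarrow> ('w \<Rightarrow> 'w \<Rightarrow> 'w) \<Rightarrow> bool"
  where "lie_algebras_isomorphic L b M c \<longleftrightarrow> (\<exists>\<Phi>. bij_betw \<Phi> L M \<and>
    (\<forall>x\<in>L. \<forall>y\<in>L. \<Phi> (x + y) = \<Phi> x + \<Phi> y) \<and>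
    (\<forall>r. \<forall>x\<in>L. \<Phi> (r *\<^sub>R x) = r *\<^sub>R \<Phi> x) \<and>
    (\<forall>x\<in>L. \<forall>y\<in>L. \<Phi> (b x y) = c (\<Phi> x) (\<Phi> y)))"

text \<open>
  The Lie algebra \<open>\<gg>(\<xi>, \<eta>)\<close>, realised on \<open>\<real>\<^sup>3\<close>: the bilinear alternating bracket which on the
  standard basis is \<open>[e\<^sub>1, e\<^sub>2] = (1 + \<xi>) (e\<^sub>2 + \<eta> e\<^sub>3)\<close>, \<open>[e\<^sub>2, e\<^sub>3] = 0\<close>,
  \<open>[e\<^sub>3, e\<^sub>1] = (1 - \<xi>) (\<eta> e\<^sub>2 - e\<^sub>3)\<close>.
\<close>

definition model_bracket :: "real \<Rightarrow> real \<Rightarrow> real ^ 3 \<Rightarrow> real ^ 3 \<Rightarrow> real ^ 3"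
  where "model_bracket \<xi> \<eta> x y =
    (x $ 1 * y $ 2 - x $ 2 * y $ 1) *\<^sub>R ((1 + \<xi>) *\<^sub>R (axis 2 1 + \<eta> *\<^sub>R axis 3 1)) +
    (x $ 3 * y $ 1 - x $ 1 * y $ 3) *\<^sub>R ((1 - \<xi>) *\<^sub>R (\<eta> *\<^sub>R axis 2 1 - axis 3 1))"

text \<open>
  Two Lie groups are locally isomorphic iff their Lie algebras are isomorphic. The model group
  \<open>G(\<xi>, \<eta>)\<close> is by definition the simply connected group with Lie algebra \<open>\<gg>(\<xi>, \<eta>)\<close>, so it
  enters only through that Lie algebra.
\<close>

definition locally_isomorphic_to_model ::
    "('g::{group_add,topological_space}, 'e::euclidean_space) chart set \<Rightarrow> real \<Rightarrow> real \<Rightarrow> bool"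
  where "locally_isomorphic_to_model A \<xi> \<eta> \<longleftrightarrow>
    lie_algebras_isomorphic (lie_algebra A) (lie_bracket A) (UNIV :: (real ^ 3) set)
      (model_bracket \<xi> \<eta>)"

end

theory Submission
  imports Defs
begin

text \<open>
  Left invariance reduces the statement to linear algebra on the Lie algebra, as follows. Tangent
  vectors are directional derivatives by Hadamard's lemma (\<open>tangent_in_chart\<close>), and every tangent
  vector at the unit extends to a smooth left invariant field because the multiplication is smooth
  (\<open>left_field_smooth\<close>). So the Lie algebra is three-dimensional, and a left invariant metric has an
  orthonormal left invariant frame (\<open>orthonormal_left_frame\<close>), in which the metric and \<open>D\<close> have
  constant coefficients. The hypotheses then translate as follows. Torsion freeness makes the
  bracket the antisymmetrisation of \<open>D\<close>. The dual connection, which exists because its defining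
  equation is tensorial, is the negative transpose of \<open>D\<close>, so that conjugate symmetry says that the
  curvature operators of \<open>D\<close> are skew (\<open>curv_skew\<close>). Finally \<open>D\<close> differs from the Levi-Civita
  connection exactly if the cubic form \<open>C = \<nabla>g\<close> does not vanish identically, and since \<open>C\<close> is
  tensorial it is then nonzero on the frame (\<open>cubic_nonzero\<close>).

  The algebraic problem is solved in an adapted orthonormal basis. The trace of \<open>ad\<close> is a nonzero
  linear form; let \<open>e1\<close> be the unit normal of its kernel. The Jacobi identity forces the kernel to be
  an abelian ideal, and a rotation brings \<open>ad e1\<close> on it to the sum of \<open>diag (p, q)\<close> and a skew matrix
  with entry \<open>a\<close>, where \<open>p + q \<noteq> 0\<close> (\<open>adapted_basis\<close>). Skewness of the curvature is the Codazzi
  equation for \<open>C\<close>: its covariant derivative by the Levi-Civita connection is totally symmetric. This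
  is a linear system for the ten components of \<open>C\<close> with coefficients in \<open>p\<close>, \<open>q\<close>, \<open>a\<close>, and it has a
  nonzero solution only if \<open>p = q\<close>, or \<open>a = 0\<close> and one of \<open>p\<close>, \<open>q\<close> vanishes
  (\<open>codazzi_solution\<close>). After rescaling \<open>e1\<close>, the first case is the Lie algebra of a solvable model of
  hyperbolic space, the second that of the product of the hyperbolic plane with a line
  (\<open>model_classification\<close>).
\<close>


section \<open>Calculus of smooth maps\<close>

lemma linear_expand_Basis:
  assumes "linear f"
  shows "f v = (\<Sum>b\<in>Basis. (v \<bullet> b) *\<^sub>R f b)"
proof -
  have "f (\<Sum>b\<in>Basis. (v \<bullet> b) *\<^sub>R b) = (\<Sum>b\<in>Basis. (v \<bullet> b) *\<^sub>R f b)"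
    using assms by (simp only: linear_sum linear_cmul)
  then show ?thesis by (simp only: euclidean_representation)
qed

lemma Ck_on_subset: "Ck_on k f S \<Longrightarrow> T \<subseteq> S \<Longrightarrow> Ck_on k f T"
  by (induction k arbitrary: f) (auto intro: continuous_on_subset)

text \<open>
  Openness of \<open>S\<close> is essential: the derivatives in the definition of \<open>C\<^sup>k\<close> are taken in full
  neighbourhoods, and only on an open set does equality on \<open>S\<close> pass to them.
\<close>

lemma Ck_on_cong:
  assumes "open S" "\<And>x. x \<in> S \<Longrightarrow> f x = g x" "Ck_on k f S"
  shows "Ck_on k g S"
  using assms(2,3)
proof (induction k arbitrary: f g)
  case 0
  then show ?case by (simp cong: continuous_on_cong)
next
  case (Suc k)
  have d: "(g has_derivative frechet_derivative f (at x)) (at x)" if "x \<in> S" for x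
  proof (rule has_derivative_transform_within_open[OF _ \<open>open S\<close> that])
    show "(f has_derivative frechet_derivative f (at x)) (at x)"
      using Suc.prems(2) that by (simp add: frechet_derivative_works[symmetric])
  qed (use Suc.prems in auto)
  have e: "frechet_derivative g (at x) = frechet_derivative f (at x)" if "x \<in> S" for x
    using frechet_derivative_at[OF d[OF that]] by simp
  show ?case
    unfolding Ck_on.simps
  proof (intro conjI ballI allI)
    fix x assume "x \<in> S"
    then show "g differentiable at x" using d by (auto simp: differentiable_def)
  next
    fix v
    show "Ck_on k (\<lambda>x. frechet_derivative g (at x) v) S"
      by (rule Suc.IH[of "\<lambda>x. frechet_derivative f (at x) v"]) (use e Suc.prems in auto)
  qed
qed

lemma Ck_on_SucI:
  assumes "open S" "\<And>x. x \<in> S \<Longrightarrow> (f has_derivative f' x) (at x)"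
    and "\<And>v. Ck_on k (\<lambda>x. f' x v) S"
  shows "Ck_on (Suc k) f S"
  unfolding Ck_on.simps
proof (intro conjI ballI allI)
  fix x assume "x \<in> S"
  then show "f differentiable at x" using assms(2) by (auto simp: differentiable_def)
next
  fix v
  show "Ck_on k (\<lambda>x. frechet_derivative f (at x) v) S"
    by (rule Ck_on_cong[OF assms(1) _ assms(3)[of v]]) (metis assms(2) frechet_derivative_at)
qed

lemma Ck_on_SucD: "Ck_on (Suc k) f S \<Longrightarrow> Ck_on k f S"
proof (induction k arbitrary: f)
  case 0
  then show ?case
    by (simp add: continuous_at_imp_continuous_on differentiable_imp_continuous_within)
next
  case (Suc k)
  then show ?case by (metis Ck_on.simps(2))
qed

lemma Ck_on_has_derivative:
  "Ck_on (Suc k) f S \<Longrightarrow> x \<in> S \<Longrightarrow> (f has_derivative frechet_derivative f (at x)) (at x)"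
  by (simp add: frechet_derivative_works[symmetric])

lemma Ck_on_const: "Ck_on k (\<lambda>x. c) S"
proof (induction k arbitrary: c)
  case (Suc k)
  then show ?case by (simp add: frechet_derivative_const)
qed simp

lemma Ck_on_linear:
  assumes "bounded_linear L" "open S"
  shows "Ck_on k L S"
proof (cases k)
  case 0
  then show ?thesis using assms by (simp add: linear_continuous_on)
next
  case (Suc j)
  show ?thesis unfolding Suc
    by (rule Ck_on_SucI[OF assms(2) bounded_linear_imp_has_derivative[OF assms(1)]])
      (rule Ck_on_const)
qed

lemma Ck_on_linear_compose:
  assumes "bounded_linear L" "open S" "Ck_on k f S"
  shows "Ck_on k (\<lambda>x. L (f x)) S"
  using assms(3)
proof (induction k arbitrary: f)
  case 0
  then show ?case using assms(1) by (simp add: bounded_linear.continuous_on)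
next
  case (Suc k)
  show ?case
    by (rule Ck_on_SucI[OF assms(2)
          bounded_linear.has_derivative[OF assms(1) Ck_on_has_derivative[OF Suc.prems]]])
      (use Suc in auto)
qed

lemma Ck_on_add:
  assumes "open S" "Ck_on k f S" "Ck_on k g S"
  shows "Ck_on k (\<lambda>x. f x + g x) S"
  using assms(2,3)
proof (induction k arbitrary: f g)
  case 0
  then show ?case by (simp add: continuous_on_add)
next
  case (Suc k)
  show ?case
    by (rule Ck_on_SucI[OF assms(1)
          has_derivative_add[OF Ck_on_has_derivative[OF Suc.prems(1)]
            Ck_on_has_derivative[OF Suc.prems(2)]]])
      (use Suc in auto)
qed

lemma Ck_on_sum:
  assumes "open S" "\<And>i. i \<in> I \<Longrightarrow> Ck_on k (f i) S"
  shows "Ck_on k (\<lambda>x. \<Sum>i\<in>I. f i x) S"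
  using assms(2)
  by (induction I rule: infinite_finite_induct) (auto intro: Ck_on_const Ck_on_add[OF assms(1)])

lemma Ck_on_scaleR:
  fixes u :: "'a::euclidean_space \<Rightarrow> real"
  assumes "open S" "Ck_on k u S" "Ck_on k f S"
  shows "Ck_on k (\<lambda>x. u x *\<^sub>R f x) S"
  using assms(2,3)
proof (induction k arbitrary: u f)
  case 0
  then show ?case by (simp add: continuous_on_scaleR)
next
  case (Suc k)
  show ?case
  proof (rule Ck_on_SucI[OF assms(1)
          has_derivative_scaleR[OF Ck_on_has_derivative[OF Suc.prems(1)]
            Ck_on_has_derivative[OF Suc.prems(2)]]])
    fix v
    show "Ck_on k (\<lambda>x. u x *\<^sub>R frechet_derivative f (at x) v + frechet_derivative u (at x) v *\<^sub>R f x) S"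
      by (intro Ck_on_add[OF assms(1)] Suc.IH Ck_on_SucD[OF Suc.prems(1)] Ck_on_SucD[OF Suc.prems(2)])
        (use Suc.prems in auto)
  qed
qed

text \<open>
  By the chain rule a directional derivative of \<open>g \<circ> f\<close> is a sum over the basis of a component of a
  derivative of \<open>f\<close> times a partial derivative of \<open>g\<close> evaluated along \<open>f\<close>. The latter is again a
  composition, with the same inner function and an outer function of one order less.
\<close>

lemma Ck_on_compose:
  assumes "open S" "open T" "f ` S \<subseteq> T" "Ck_on k f S" "Ck_on k g T"
  shows "Ck_on k (\<lambda>x. g (f x)) S"
  using assms(4,5)
proof (induction k arbitrary: g)
  case 0
  then show ?case using assms(3) by (auto intro: continuous_on_compose2)
next
  case (Suc k)
  let ?D = "\<lambda>x v. \<Sum>b\<in>Basis. (frechet_derivative f (at x) v \<bullet> b) *\<^sub>R frechet_derivative g (at (f x)) b"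
  show ?case
  proof (rule Ck_on_SucI[OF assms(1), where f' = ?D])
    fix x assume x: "x \<in> S"
    have g: "(g has_derivative frechet_derivative g (at (f x))) (at (f x))"
      using Ck_on_has_derivative[OF Suc.prems(2)] x assms(3) by auto
    have lin: "linear (frechet_derivative g (at (f x)))"
      using g has_derivative_linear by auto
    have "frechet_derivative g (at (f x)) (frechet_derivative f (at x) v) = ?D x v" for v
      by (rule linear_expand_Basis[OF lin])
    then show "((\<lambda>x. g (f x)) has_derivative ?D x) (at x)"
      using diff_chain_at[OF Ck_on_has_derivative[OF Suc.prems(1) x] g] by (simp add: o_def)
  next
    fix v
    show "Ck_on k (\<lambda>x. ?D x v) S"
    proof (intro Ck_on_sum Ck_on_scaleR assms(1))
      fix b :: 'b assume "b \<in> Basis"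
      show "Ck_on k (\<lambda>x. frechet_derivative f (at x) v \<bullet> b) S"
        by (rule Ck_on_linear_compose[OF bounded_linear_inner_left assms(1)]) (use Suc.prems in auto)
      show "Ck_on k (\<lambda>x. frechet_derivative g (at (f x)) b) S"
        by (rule Suc.IH[OF Ck_on_SucD[OF Suc.prems(1)]]) (use Suc.prems in auto)
    qed
  qed
qed

lemma Ck_on_local:
  assumes "\<And>x. x \<in> S \<Longrightarrow> \<exists>T. open T \<and> x \<in> T \<and> Ck_on k f T"
  shows "Ck_on k f S"
  using assms
proof (induction k arbitrary: f)
  case 0
  have "continuous (at x) f" if "x \<in> S" for x
    using 0[OF that] by (auto simp: continuous_on_eq_continuous_at)
  then show ?case by (simp add: continuous_at_imp_continuous_on)
next
  case (Suc k)
  show ?case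
    unfolding Ck_on.simps
  proof (intro conjI ballI allI)
    fix x assume "x \<in> S"
    then show "f differentiable at x" using Suc.prems by auto
  next
    fix v
    show "Ck_on k (\<lambda>x. frechet_derivative f (at x) v) S"
      by (rule Suc.IH) (use Suc.prems in \<open>auto; blast\<close>)
  qed
qed

lemma smooth_on_subset: "smooth_on f S \<Longrightarrow> T \<subseteq> S \<Longrightarrow> smooth_on f T"
  by (auto simp: smooth_on_def intro: Ck_on_subset)

lemma smooth_on_cong:
  "open S \<Longrightarrow> (\<And>x. x \<in> S \<Longrightarrow> f x = g x) \<Longrightarrow> smooth_on f S \<Longrightarrow> smooth_on g S"
  unfolding smooth_on_def using Ck_on_cong by blast

lemma smooth_on_const: "smooth_on (\<lambda>x. c) S"
  by (simp add: smooth_on_def Ck_on_const)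

lemma smooth_on_linear: "bounded_linear L \<Longrightarrow> open S \<Longrightarrow> smooth_on L S"
  by (simp add: smooth_on_def Ck_on_linear)

lemma smooth_on_add:
  "open S \<Longrightarrow> smooth_on f S \<Longrightarrow> smooth_on g S \<Longrightarrow> smooth_on (\<lambda>x. f x + g x) S"
  by (simp add: smooth_on_def Ck_on_add)

lemma smooth_on_mult:
  fixes f g :: "'a::euclidean_space \<Rightarrow> real"
  shows "open S \<Longrightarrow> smooth_on f S \<Longrightarrow> smooth_on g S \<Longrightarrow> smooth_on (\<lambda>x. f x * g x) S"
  using Ck_on_scaleR[of S _ f g] by (simp add: smooth_on_def)

lemma smooth_on_compose:
  "open S \<Longrightarrow> open T \<Longrightarrow> f ` S \<subseteq> T \<Longrightarrow> smooth_on f S \<Longrightarrow> smooth_on g T \<Longrightarrow>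
    smooth_on (\<lambda>x. g (f x)) S"
  unfolding smooth_on_def using Ck_on_compose by blast

lemma smooth_on_local:
  assumes "\<And>x. x \<in> S \<Longrightarrow> \<exists>T. open T \<and> x \<in> T \<and> smooth_on f T"
  shows "smooth_on f S"
  unfolding smooth_on_def
proof (intro allI Ck_on_local)
  fix k x assume "x \<in> S"
  then show "\<exists>T. open T \<and> x \<in> T \<and> Ck_on k f T"
    using assms unfolding smooth_on_def by meson
qed

lemma smooth_on_deriv: "smooth_on f S \<Longrightarrow> smooth_on (\<lambda>x. frechet_derivative f (at x) v) S"
  unfolding smooth_on_def using Ck_on.simps(2) by blast

lemma smooth_on_has_derivative:
  "smooth_on f S \<Longrightarrow> x \<in> S \<Longrightarrow> (f has_derivative frechet_derivative f (at x)) (at x)"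
  unfolding smooth_on_def using Ck_on_has_derivative by blast

lemma smooth_on_continuous: "smooth_on f S \<Longrightarrow> continuous_on S f"
  unfolding smooth_on_def using Ck_on.simps(1) by blast

lemma Ck_on_zero: "Ck_on k f S \<Longrightarrow> continuous_on S f"
  by (induction k) (simp, metis Ck_on_SucD)

lemma ray_in_ball:
  fixes a x :: "'a::euclidean_space"
  assumes "x \<in> ball a r" "t \<in> cbox 0 (1::real)"
  shows "a + t *\<^sub>R (x - a) \<in> ball a r"
proof -
  have "norm (t *\<^sub>R (x - a)) \<le> 1 * norm (x - a)"
    using assms(2) unfolding norm_scaleR by (intro mult_right_mono) auto
  then show ?thesis using assms(1) by (simp add: dist_norm norm_minus_commute)
qed

lemma continuous_on_ray:
  fixes k :: "'a::euclidean_space \<Rightarrow> 'b::topological_space"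
  assumes "continuous_on (ball a r) k"
  shows "continuous_on (ball a r \<times> cbox 0 1) (\<lambda>z. k (a + snd z *\<^sub>R (fst z - a)))"
proof (rule continuous_on_compose2[OF assms])
  show "continuous_on (ball a r \<times> cbox 0 1) (\<lambda>z. a + snd z *\<^sub>R (fst z - a))"
    by (intro continuous_intros)
  show "(\<lambda>z. a + snd z *\<^sub>R (fst z - a)) ` (ball a r \<times> cbox 0 1) \<subseteq> ball a r"
    using ray_in_ball by (metis (no_types, lifting) SigmaE fst_conv image_subsetI snd_conv)
qed

lemma continuous_on_segment:
  fixes k :: "'a::euclidean_space \<Rightarrow> 'b::topological_space"
  assumes "continuous_on (ball a r) k" "x \<in> ball a r"
  shows "continuous_on (cbox 0 1) (\<lambda>t. k (a + t *\<^sub>R (x - a)))"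
proof (rule continuous_on_compose2[OF assms(1)])
  show "continuous_on (cbox 0 1) (\<lambda>t. a + t *\<^sub>R (x - a))"
    by (intro continuous_intros)
  show "(\<lambda>t. a + t *\<^sub>R (x - a)) ` cbox 0 1 \<subseteq> ball a r"
    using ray_in_ball[OF assms(2)] by blast
qed

text \<open>
  Differentiating under the integral sign brings out one more factor \<open>t\<close>, so the statement has to
  allow an arbitrary power of \<open>t\<close> as a weight for the induction on \<open>k\<close> to go through.
\<close>

lemma Ck_on_ray_integral:
  fixes h :: "'a::euclidean_space \<Rightarrow> real"
  assumes "Ck_on k h (ball a r)"
  shows "Ck_on k (\<lambda>x. integral (cbox 0 1) (\<lambda>t. t ^ m * h (a + t *\<^sub>R (x - a)))) (ball a r)"
  using assms
proof (induction k arbitrary: h m)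
  case 0
  have "continuous_on (ball a r \<times> cbox 0 1) (\<lambda>(x, t). t ^ m * h (a + t *\<^sub>R (x - a)))"
    using 0 unfolding split_beta Ck_on.simps
    by (intro continuous_intros continuous_on_ray)
  then show ?case by (simp only: Ck_on.simps integral_continuous_on_param)
next
  case (Suc k)
  \<comment> \<open>The derivative of \<open>h\<close> as a bounded linear form, so that the Leibniz rule applies.\<close>
  define H where "H y = (\<Sum>b\<in>Basis. frechet_derivative h (at y) b *\<^sub>R blinfun_inner_left b)" for y
  have H: "blinfun_apply (H y) v = frechet_derivative h (at y) v" if "y \<in> ball a r" for y v
  proof -
    have "linear (frechet_derivative h (at y))"
      using Ck_on_has_derivative[OF Suc.prems that] has_derivative_linear by blast
    from linear_expand_Basis[OF this, of v] show ?thesis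
      by (simp add: H_def blinfun.sum_left blinfun.scaleR_left inner_commute mult.commute)
  qed
  have contH: "continuous_on (ball a r) H"
  proof -
    have "continuous_on (ball a r) (\<lambda>y. frechet_derivative h (at y) b)" for b
      by (rule Ck_on_zero[of k]) (use Suc.prems in simp)
    then show ?thesis unfolding H_def by (intro continuous_intros)
  qed
  have conth: "continuous_on (ball a r) h"
    using Ck_on_zero[OF Suc.prems] .
  let ?F = "\<lambda>x t. t ^ m * h (a + t *\<^sub>R (x - a))"
  let ?G = "\<lambda>x t. t ^ Suc m *\<^sub>R H (a + t *\<^sub>R (x - a))"
  have contG: "continuous_on (ball a r \<times> cbox 0 1) (\<lambda>(x, t). ?G x t)"
    unfolding split_beta
    by (intro continuous_intros continuous_on_ray[OF contH])
  have der: "((\<lambda>x. ?F x t) has_derivative blinfun_apply (?G x t)) (at x within ball a r)"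
    if "x \<in> ball a r" "t \<in> cbox 0 1" for x t
  proof -
    let ?y = "a + t *\<^sub>R (x - a)"
    have y: "?y \<in> ball a r" using ray_in_ball that by auto
    have "((\<lambda>x. a + t *\<^sub>R (x - a)) has_derivative (\<lambda>v. t *\<^sub>R v)) (at x)"
      by (auto intro!: derivative_eq_intros)
    from diff_chain_at[OF this Ck_on_has_derivative[OF Suc.prems y]]
    have "((\<lambda>x. h (a + t *\<^sub>R (x - a))) has_derivative (\<lambda>v. frechet_derivative h (at ?y) (t *\<^sub>R v))) (at x)"
      by (simp add: o_def)
    then have "((\<lambda>x. ?F x t) has_derivative (\<lambda>v. t ^ m * frechet_derivative h (at ?y) (t *\<^sub>R v))) (at x)"
      by (rule has_derivative_mult_right)
    moreover have "(\<lambda>v. t ^ m * frechet_derivative h (at ?y) (t *\<^sub>R v)) = blinfun_apply (?G x t)"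
      by (simp add: fun_eq_iff H[OF y, symmetric] blinfun.scaleR_left blinfun.scaleR_right)
    ultimately show ?thesis by (metis has_derivative_at_withinI)
  qed
  have intF: "?F x integrable_on cbox 0 1" if "x \<in> ball a r" for x
    by (intro integrable_continuous continuous_intros continuous_on_segment[OF conth that])
  have intG: "?G x integrable_on cbox 0 1" if "x \<in> ball a r" for x
    by (intro integrable_continuous continuous_intros continuous_on_segment[OF contH that])
  have D: "((\<lambda>x. integral (cbox 0 1) (?F x)) has_derivative
      blinfun_apply (integral (cbox 0 1) (?G x))) (at x)" if "x \<in> ball a r" for x
    using leibniz_rule[where U = "ball a r" and f = ?F and fx = ?G and ?x0.0 = x, OF der intF contG that convex_ball]
      at_within_open[OF that open_ball] by simp
  show ?case
  proof (rule Ck_on_SucI[OF open_ball D])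
    fix v
    have *: "blinfun_apply (integral (cbox 0 1) (?G x)) v =
      integral (cbox 0 1) (\<lambda>t. t ^ Suc m * frechet_derivative h (at (a + t *\<^sub>R (x - a))) v)"
      if "x \<in> ball a r" for x
    proof -
      have "blinfun_apply (integral (cbox 0 1) (?G x)) v = integral (cbox 0 1) (\<lambda>t. blinfun_apply (?G x t) v)"
        using integral_linear[OF intG[OF that] blinfun.bounded_linear_left[of v]]
        by (simp add: o_def)
      also have "\<dots> = integral (cbox 0 1) (\<lambda>t. t ^ Suc m * frechet_derivative h (at (a + t *\<^sub>R (x - a))) v)"
        by (rule integral_cong) (use ray_in_ball[OF that] in \<open>simp add: blinfun.scaleR_left H\<close>)
      finally show ?thesis .
    qed
    show "Ck_on k (\<lambda>x. blinfun_apply (integral (cbox 0 1) (?G x)) v) (ball a r)"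
      by (rule Ck_on_cong[OF open_ball *[symmetric] Suc.IH]) (use Suc.prems in auto)
  qed
qed

text \<open>
  Hadamard's lemma: by the fundamental theorem of calculus along the segment from \<open>a\<close> to \<open>x\<close>, the
  coefficient \<open>G b x\<close> can be taken to be the integral over that segment of the partial derivative
  of \<open>h\<close> in direction \<open>b\<close>.
\<close>

lemma hadamard:
  fixes h :: "'a::euclidean_space \<Rightarrow> real"
  assumes "smooth_on h (ball a r)" "r > 0"
  obtains G where "\<And>b. smooth_on (G b) (ball a r)"
    and "\<And>b. G b a = frechet_derivative h (at a) b"
    and "\<And>x. x \<in> ball a r \<Longrightarrow> h x = h a + (\<Sum>b\<in>Basis. ((x - a) \<bullet> b) * G b x)"
proof
  let ?G = "\<lambda>b x. integral (cbox 0 1) (\<lambda>t. t ^ 0 * frechet_derivative h (at (a + t *\<^sub>R (x - a))) b)"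
  show "smooth_on (?G b) (ball a r)" for b
    using smooth_on_deriv[OF assms(1), of b] Ck_on_ray_integral unfolding smooth_on_def by blast
  show "?G b a = frechet_derivative h (at a) b" for b
    by simp
  fix x assume x: "x \<in> ball a r"
  let ?d = "\<lambda>t v. frechet_derivative h (at (a + t *\<^sub>R (x - a))) v"
  have int: "((\<lambda>t. ?d t (x - a)) has_integral h (a + 1 *\<^sub>R (x - a)) - h (a + 0 *\<^sub>R (x - a))) {0..1}"
  proof (rule fundamental_theorem_of_calculus)
    fix t :: real assume t: "t \<in> {0..1}"
    have y: "a + t *\<^sub>R (x - a) \<in> ball a r" using ray_in_ball[OF x] t by simp
    have "((\<lambda>t. a + t *\<^sub>R (x - a)) has_derivative (\<lambda>s. s *\<^sub>R (x - a))) (at t)"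
      by (auto intro!: derivative_eq_intros)
    from diff_chain_at[OF this smooth_on_has_derivative[OF assms(1) y]]
    have "((\<lambda>t. h (a + t *\<^sub>R (x - a))) has_derivative (\<lambda>s. ?d t (s *\<^sub>R (x - a)))) (at t)"
      by (simp add: o_def)
    moreover have "?d t (s *\<^sub>R (x - a)) = s * ?d t (x - a)" for s
      using has_derivative_linear[OF smooth_on_has_derivative[OF assms(1) y]] by (simp add: linear_cmul)
    ultimately show "((\<lambda>t. h (a + t *\<^sub>R (x - a))) has_vector_derivative ?d t (x - a)) (at t within {0..1})"
      by (simp add: has_vector_derivative_def has_derivative_at_withinI)
  qed simp
  have sum: "?d t (x - a) = (\<Sum>b\<in>Basis. ((x - a) \<bullet> b) * ?d t b)" if "t \<in> {0..1}" for t
  proof -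
    have y: "a + t *\<^sub>R (x - a) \<in> ball a r" using ray_in_ball[OF x] that by simp
    show ?thesis
      using linear_expand_Basis[OF has_derivative_linear[OF smooth_on_has_derivative[OF assms(1) y]], of "x - a"]
      by simp
  qed
  have contd: "(\<lambda>t. ?d t b) integrable_on {0..1}" for b
    using continuous_on_segment[OF smooth_on_continuous[OF smooth_on_deriv[OF assms(1)]] x]
    by (simp add: integrable_continuous_interval)
  have "h x - h a = integral {0..1} (\<lambda>t. ?d t (x - a))"
    using integral_unique[OF int] by simp
  also have "\<dots> = integral {0..1} (\<lambda>t. \<Sum>b\<in>Basis. ((x - a) \<bullet> b) * ?d t b)"
    by (rule integral_cong) (rule sum)
  also have "\<dots> = (\<Sum>b\<in>Basis. ((x - a) \<bullet> b) * integral {0..1} (\<lambda>t. ?d t b))"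
    using contd by (simp add: integral_sum integrable_on_mult_right)
  finally show "h x = h a + (\<Sum>b\<in>Basis. ((x - a) \<bullet> b) * ?G b x)" by simp
qed

section \<open>Smooth functions on a manifold\<close>

locale smooth_manifold =
  fixes A :: "('m::{t2_space,second_countable_topology}, 'e::euclidean_space) chart set"
  assumes atlas: "smooth_atlas A"
begin

lemma chart_open:
  assumes "(U, \<phi>) \<in> A"
  shows "open U" "inj_on \<phi> U" "continuous_on U \<phi>" "open (\<phi> ` U)"
  using assms atlas unfolding smooth_atlas_def is_chart_def homeomorphism_def
  by (fastforce intro: inj_on_inverseI)+

lemma chart_open_image:
  assumes "(U, \<phi>) \<in> A" "open W" "W \<subseteq> U"
  shows "open (\<phi> ` W)"
proof -
  obtain \<psi> where h: "homeomorphism U (\<phi> ` U) \<phi> \<psi>"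
    using assms(1) atlas unfolding smooth_atlas_def is_chart_def by fastforce
  have "openin (top_of_set U) W"
    using assms chart_open by (simp add: openin_open_eq)
  then have "openin (top_of_set (\<phi> ` U)) (\<phi> ` W)"
    by (rule homeomorphism_imp_open_map[OF h])
  then show ?thesis using chart_open(4)[OF assms(1)] openin_open_trans by blast
qed

lemma chart_cover: obtains U \<phi> where "(U, \<phi>) \<in> A" "p \<in> U"
proof -
  have "p \<in> \<Union>(fst ` A)" using atlas unfolding smooth_atlas_def by simp
  then obtain c where "c \<in> A" "p \<in> fst c" by blast
  then show thesis using that[of "fst c" "snd c"] by simp
qed

lemma chart_inv: "(U, \<phi>) \<in> A \<Longrightarrow> q \<in> U \<Longrightarrow> inv_into U \<phi> (\<phi> q) = q"
  using chart_open(2) by simp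

lemma chart_open_vimage:
  assumes "(U, \<phi>) \<in> A" "open B"
  shows "open (U \<inter> \<phi> -` B)"
  using continuous_open_preimage[OF chart_open(3,1)[OF assms(1)] assms(2)] .

lemma transition_smooth:
  "(U, \<phi>) \<in> A \<Longrightarrow> (V, \<psi>) \<in> A \<Longrightarrow> smooth_on (\<lambda>x. \<psi> (inv_into U \<phi> x)) (\<phi> ` (U \<inter> V))"
  using atlas unfolding smooth_atlas_def comp_def by blast

lemma smooth_fun_on_chart:
  "smooth_fun_on A W f \<Longrightarrow> (U, \<phi>) \<in> A \<Longrightarrow> smooth_on (\<lambda>x. f (inv_into U \<phi> x)) (\<phi> ` (U \<inter> W))"
  unfolding smooth_fun_on_def comp_def by blast

lemma smooth_fun_on_subset: "smooth_fun_on A W f \<Longrightarrow> V \<subseteq> W \<Longrightarrow> smooth_fun_on A V f"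
  unfolding smooth_fun_on_def by (blast intro: smooth_on_subset)

lemma open_chart_Int: "(U, \<phi>) \<in> A \<Longrightarrow> open W \<Longrightarrow> open (\<phi> ` (U \<inter> W))"
  by (rule chart_open_image) (auto dest: chart_open)

lemma smooth_fun_on_cong:
  assumes "open W" "\<And>q. q \<in> W \<Longrightarrow> f q = h q" "smooth_fun_on A W f"
  shows "smooth_fun_on A W h"
  unfolding smooth_fun_on_def comp_def
proof clarify
  fix U \<phi> assume c: "(U, \<phi>) \<in> A"
  show "smooth_on (\<lambda>x. h (inv_into U \<phi> x)) (\<phi> ` (U \<inter> W))"
    by (rule smooth_on_cong[OF open_chart_Int[OF c assms(1)] _ smooth_fun_on_chart[OF assms(3) c]])
      (use assms(2) c chart_inv in auto)
qed

lemma smooth_fun_on_const: "smooth_fun_on A W (\<lambda>q. c)"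
  by (auto simp: smooth_fun_on_def comp_def smooth_on_const)

lemma smooth_fun_on_add:
  "open W \<Longrightarrow> smooth_fun_on A W f \<Longrightarrow> smooth_fun_on A W h \<Longrightarrow> smooth_fun_on A W (\<lambda>q. f q + h q)"
  using open_chart_Int unfolding smooth_fun_on_def comp_def
  by (fastforce intro: smooth_on_add)

lemma smooth_fun_on_mult:
  "open W \<Longrightarrow> smooth_fun_on A W f \<Longrightarrow> smooth_fun_on A W h \<Longrightarrow> smooth_fun_on A W (\<lambda>q. f q * h q)"
  using open_chart_Int unfolding smooth_fun_on_def comp_def
  by (fastforce intro: smooth_on_mult)

lemma smooth_fun_on_diff:
  assumes "open W" "smooth_fun_on A W f" "smooth_fun_on A W h"
  shows "smooth_fun_on A W (\<lambda>q. f q - h q)"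
  using smooth_fun_on_add[OF assms(1,2) smooth_fun_on_mult[OF assms(1) smooth_fun_on_const[of W "-1"] assms(3)]]
  by simp

lemma smooth_fun_on_local:
  assumes "open W" "\<And>p. p \<in> W \<Longrightarrow> \<exists>V. open V \<and> p \<in> V \<and> smooth_fun_on A V f"
  shows "smooth_fun_on A W f"
  unfolding smooth_fun_on_def comp_def
proof (clarify, rule smooth_on_local)
  fix U \<phi> x assume c: "(U, \<phi>) \<in> A" and "x \<in> \<phi> ` (U \<inter> W)"
  then obtain p where p: "p \<in> U" "p \<in> W" "x = \<phi> p" by blast
  obtain V where "open V" "p \<in> V" "smooth_fun_on A V f" using assms(2) p by blast
  then show "\<exists>T. open T \<and> x \<in> T \<and> smooth_on (\<lambda>x. f (inv_into U \<phi> x)) T"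
    using c p open_chart_Int smooth_fun_on_chart by (intro exI[of _ "\<phi> ` (U \<inter> V)"]) blast
qed

text \<open>Smoothness may be tested in a single chart, because the transition maps are smooth.\<close>

lemma smooth_fun_onI:
  assumes c: "(U, \<phi>) \<in> A" and W: "open W" "W \<subseteq> U"
    and f: "smooth_on (\<lambda>x. f (inv_into U \<phi> x)) (\<phi> ` W)"
  shows "smooth_fun_on A W f"
  unfolding smooth_fun_on_def comp_def
proof clarify
  fix V \<psi> assume d: "(V, \<psi>) \<in> A"
  have o: "open (\<psi> ` (V \<inter> W))" by (rule open_chart_Int[OF d W(1)])
  have "smooth_on (\<lambda>y. \<phi> (inv_into V \<psi> y)) (\<psi> ` (V \<inter> W))"
    by (rule smooth_on_subset[OF transition_smooth[OF d c]]) (use W in blast)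
  then have "smooth_on (\<lambda>y. f (inv_into U \<phi> (\<phi> (inv_into V \<psi> y)))) (\<psi> ` (V \<inter> W))"
    by (intro smooth_on_compose[OF o chart_open_image[OF c W] _ _ f]) (auto simp: chart_inv[OF d])
  then show "smooth_on (\<lambda>y. f (inv_into V \<psi> y)) (\<psi> ` (V \<inter> W))"
    by (rule smooth_on_cong[OF o, rotated]) (use W c d chart_inv in auto)
qed

lemma smooth_fun_on_chart_compose:
  assumes c: "(U, \<phi>) \<in> A" and "open B" "smooth_on h B"
  shows "smooth_fun_on A (U \<inter> \<phi> -` B) (\<lambda>q. h (\<phi> q))"
proof (rule smooth_fun_onI[OF c chart_open_vimage[OF c assms(2)]])
  have "open (\<phi> ` (U \<inter> \<phi> -` B))"
    by (rule chart_open_image[OF c chart_open_vimage[OF c assms(2)]]) auto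
  then show "smooth_on (\<lambda>x. h (\<phi> (inv_into U \<phi> x))) (\<phi> ` (U \<inter> \<phi> -` B))"
    by (rule smooth_on_cong[OF _ _ smooth_on_subset[OF assms(3)]]) (auto simp: chart_inv[OF c])
qed auto

lemma smooth_chart_component:
  assumes c: "(U, \<phi>) \<in> A"
  shows "smooth_fun_on A U (\<lambda>q. \<phi> q \<bullet> b)"
  using smooth_fun_on_chart_compose[OF c open_UNIV smooth_on_linear[OF bounded_linear_inner_left[of b]]]
  by simp

lemma smooth_nearI: "open W \<Longrightarrow> p \<in> W \<Longrightarrow> smooth_fun_on A W f \<Longrightarrow> f \<in> smooth_near A p"
  unfolding smooth_near_def by blast

lemma smooth_near_cong:
  assumes "f \<in> smooth_near A p" "open W" "p \<in> W" "\<And>q. q \<in> W \<Longrightarrow> f q = h q"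
  shows "h \<in> smooth_near A p"
proof -
  obtain V where V: "open V" "p \<in> V" "smooth_fun_on A V f"
    using assms(1) unfolding smooth_near_def by blast
  show ?thesis
  proof (rule smooth_nearI[of "V \<inter> W"])
    show "smooth_fun_on A (V \<inter> W) h"
      by (rule smooth_fun_on_cong[OF _ _ smooth_fun_on_subset[OF V(3)]]) (use V assms in auto)
  qed (use V assms in auto)
qed

lemma smooth_near2:
  assumes "f \<in> smooth_near A p" "h \<in> smooth_near A p"
  obtains W where "open W" "p \<in> W" "smooth_fun_on A W f" "smooth_fun_on A W h"
proof -
  obtain V W where "open V" "p \<in> V" "smooth_fun_on A V f" "open W" "p \<in> W" "smooth_fun_on A W h"
    using assms unfolding smooth_near_def by blast
  then show thesis
    by (intro that[of "V \<inter> W"]) (auto intro: smooth_fun_on_subset)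
qed

lemma smooth_near_const: "(\<lambda>q. c) \<in> smooth_near A p"
  by (rule smooth_nearI[of UNIV]) (auto intro: smooth_fun_on_const)

lemma smooth_near_add:
  assumes "f \<in> smooth_near A p" "h \<in> smooth_near A p"
  shows "(\<lambda>q. f q + h q) \<in> smooth_near A p"
  using smooth_near2[OF assms] by (metis smooth_fun_on_add smooth_nearI)

lemma smooth_near_mult:
  assumes "f \<in> smooth_near A p" "h \<in> smooth_near A p"
  shows "(\<lambda>q. f q * h q) \<in> smooth_near A p"
  using smooth_near2[OF assms] by (metis smooth_fun_on_mult smooth_nearI)

lemma smooth_near_sum:
  "(\<And>i. i \<in> I \<Longrightarrow> f i \<in> smooth_near A p) \<Longrightarrow> (\<lambda>q. \<Sum>i\<in>I. f i q) \<in> smooth_near A p"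
  by (induction I rule: infinite_finite_induct) (auto intro: smooth_near_const smooth_near_add)

section \<open>Tangent vectors are directional derivatives\<close>

lemma tangent_add:
  "v \<in> tangent_space A p \<Longrightarrow> f \<in> smooth_near A p \<Longrightarrow> h \<in> smooth_near A p \<Longrightarrow>
    v (\<lambda>q. f q + h q) = v f + v h"
  unfolding tangent_space_def by (auto simp: plus_fun_def)

lemma tangent_mult:
  "v \<in> tangent_space A p \<Longrightarrow> f \<in> smooth_near A p \<Longrightarrow> h \<in> smooth_near A p \<Longrightarrow>
    v (\<lambda>q. f q * h q) = f p * v h + h p * v f"
  unfolding tangent_space_def by (auto simp: times_fun_def)

lemma tangent_scale:
  "v \<in> tangent_space A p \<Longrightarrow> f \<in> smooth_near A p \<Longrightarrow> v (\<lambda>q. c * f q) = c * v f"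
  unfolding tangent_space_def by (auto simp: scaleR_fun_def)

lemma tangent_outside: "v \<in> tangent_space A p \<Longrightarrow> f \<notin> smooth_near A p \<Longrightarrow> v f = 0"
  unfolding tangent_space_def by auto

lemma tangent_const: "v \<in> tangent_space A p \<Longrightarrow> v (\<lambda>q. c) = 0"
  using tangent_mult[of v p "\<lambda>q. 1" "\<lambda>q. 1"] tangent_scale[of v p "\<lambda>q. 1" c]
  by (simp add: smooth_near_const)

lemma tangent_sum:
  assumes "v \<in> tangent_space A p" "\<And>i. i \<in> I \<Longrightarrow> f i \<in> smooth_near A p"
  shows "v (\<lambda>q. \<Sum>i\<in>I. f i q) = (\<Sum>i\<in>I. v (f i))"
  using assms(2)
  by (induction I rule: infinite_finite_induct)
    (auto simp: tangent_const[OF assms(1)] tangent_add[OF assms(1)] smooth_near_sum)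

lemma tangent_diff:
  assumes "v \<in> tangent_space A p" "f \<in> smooth_near A p" "h \<in> smooth_near A p"
  shows "v (\<lambda>q. f q - h q) = v f - v h"
  using tangent_add[OF assms(1,2) smooth_near_mult[OF smooth_near_const[of "-1"] assms(3)]]
    tangent_scale[OF assms(1,3), of "-1"] by simp

text \<open>
  If \<open>f\<close> and \<open>h\<close> agree on \<open>W\<close>, then \<open>f - h\<close> equals its product with the indicator function of the
  complement of \<open>W\<close>. Both factors vanish at \<open>p\<close>, so the Leibniz rule kills the product.
\<close>

lemma tangent_germ:
  assumes v: "v \<in> tangent_space A p" and f: "f \<in> smooth_near A p"
    and W: "open W" "p \<in> W" "\<And>q. q \<in> W \<Longrightarrow> f q = h q"
  shows "v f = v h"
proof -
  let ?c = "\<lambda>q. if q \<in> W then 0 else (1::real)"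
  have h: "h \<in> smooth_near A p" by (rule smooth_near_cong[OF f W])
  have c: "?c \<in> smooth_near A p"
    by (rule smooth_near_cong[OF smooth_near_const[of 0] W(1,2)]) simp
  have d: "(\<lambda>q. f q - h q) \<in> smooth_near A p"
    using smooth_near_add[OF f smooth_near_mult[OF smooth_near_const[of "-1"] h]] by simp
  have "(\<lambda>q. f q - h q) = (\<lambda>q. (f q - h q) * ?c q)" using W(3) by auto
  then have "v (\<lambda>q. f q - h q) = v (\<lambda>q. (f q - h q) * ?c q)" by simp
  also have "\<dots> = 0" using tangent_mult[OF v d c] W by simp
  finally show ?thesis using tangent_diff[OF v f h] by simp
qed

text \<open>
  The value \<open>0\<close> outside the functions that are smooth near \<open>p\<close> is the one prescribed for tangent
  vectors, so that these derivations are elements of the tangent space as it stands.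
\<close>

definition chart_vec :: "'m set \<Rightarrow> ('m \<Rightarrow> 'e) \<Rightarrow> 'm \<Rightarrow> 'e \<Rightarrow> 'm tvec"
  where "chart_vec U \<phi> p w f =
    (if f \<in> smooth_near A p then frechet_derivative (\<lambda>x. f (inv_into U \<phi> x)) (at (\<phi> p)) w else 0)"

lemma near_has_derivative:
  assumes c: "(U, \<phi>) \<in> A" "p \<in> U" and f: "f \<in> smooth_near A p"
  shows "((\<lambda>x. f (inv_into U \<phi> x)) has_derivative
    frechet_derivative (\<lambda>x. f (inv_into U \<phi> x)) (at (\<phi> p))) (at (\<phi> p))"
proof -
  obtain W where "p \<in> W" "smooth_fun_on A W f" using f unfolding smooth_near_def by blast
  then show ?thesis
    using smooth_on_has_derivative[OF smooth_fun_on_chart[OF _ c(1)]] c by blast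
qed

lemma chart_vec_tangent:
  assumes c: "(U, \<phi>) \<in> A" "p \<in> U"
  shows "chart_vec U \<phi> p w \<in> tangent_space A p"
  unfolding tangent_space_def mem_Collect_eq
proof (intro conjI ballI allI impI)
  fix f h assume f: "f \<in> smooth_near A p" and h: "h \<in> smooth_near A p"
  note D = near_has_derivative[OF c]
  have s: "f + h \<in> smooth_near A p" "f * h \<in> smooth_near A p"
    using smooth_near_add[OF f h] smooth_near_mult[OF f h] by (simp_all add: plus_fun_def times_fun_def)
  show "chart_vec U \<phi> p w (f + h) = chart_vec U \<phi> p w f + chart_vec U \<phi> p w h"
    using frechet_derivative_at[OF has_derivative_add[OF D[OF f] D[OF h]], symmetric] f h s
    by (simp add: chart_vec_def plus_fun_def)
  show "chart_vec U \<phi> p w (f * h) = f p * chart_vec U \<phi> p w h + h p * chart_vec U \<phi> p w f"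
    using frechet_derivative_at[OF has_derivative_mult[OF D[OF f] D[OF h]], symmetric] f h s
    by (simp add: chart_vec_def times_fun_def chart_inv[OF c])
next
  fix a f assume f: "f \<in> smooth_near A p"
  have s: "a *\<^sub>R f \<in> smooth_near A p"
    using smooth_near_mult[OF smooth_near_const[of a] f] by (simp add: scaleR_fun_def)
  show "chart_vec U \<phi> p w (a *\<^sub>R f) = a * chart_vec U \<phi> p w f"
    using frechet_derivative_at[OF has_derivative_mult_right[OF near_has_derivative[OF c f], of a], symmetric] f s
    by (simp add: chart_vec_def scaleR_fun_def)
qed (simp add: chart_vec_def)

lemma chart_vec_linear:
  assumes c: "(U, \<phi>) \<in> A" "p \<in> U"
  shows "linear (chart_vec U \<phi> p)"
proof -
  have l: "linear (frechet_derivative (\<lambda>x. f (inv_into U \<phi> x)) (at (\<phi> p)))" if "f \<in> smooth_near A p" for f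
    using near_has_derivative[OF c that] has_derivative_linear by blast
  show ?thesis
    by (intro linearI ext)
      (auto simp: chart_vec_def plus_fun_def scaleR_fun_def linear_add[OF l] linear_cmul[OF l])
qed

lemma chart_component_near:
  assumes c: "(U, \<phi>) \<in> A" "p \<in> U"
  shows "(\<lambda>q. \<phi> q \<bullet> b) \<in> smooth_near A p"
  using smooth_nearI[OF chart_open(1)[OF c(1)] c(2) smooth_chart_component[OF c(1)]] .

lemma chart_vec_component:
  assumes c: "(U, \<phi>) \<in> A" "p \<in> U"
  shows "chart_vec U \<phi> p w (\<lambda>q. \<phi> q \<bullet> b) = w \<bullet> b"
proof -
  have "((\<lambda>x. \<phi> (inv_into U \<phi> x) \<bullet> b) has_derivative (\<lambda>w. w \<bullet> b)) (at (\<phi> p))"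
  proof (rule has_derivative_transform_within_open[OF _ chart_open(4)[OF c(1)]])
    show "((\<lambda>x. x \<bullet> b) has_derivative (\<lambda>w. w \<bullet> b)) (at (\<phi> p))"
      by (auto intro!: derivative_eq_intros)
  qed (use c chart_inv in auto)
  from frechet_derivative_at[OF this, symmetric] show ?thesis
    using chart_component_near[OF c] by (simp add: chart_vec_def)
qed

text \<open>
  By Hadamard's lemma \<open>f\<close> is, near \<open>p\<close>, a constant plus a sum of products of functions one of
  which is a coordinate function vanishing at \<open>p\<close>; the Leibniz rule then computes \<open>v f\<close>.
\<close>

lemma tangent_in_chart:
  assumes c: "(U, \<phi>) \<in> A" "p \<in> U" and v: "v \<in> tangent_space A p"
  shows "v = chart_vec U \<phi> p (\<Sum>b\<in>Basis. v (\<lambda>q. \<phi> q \<bullet> b) *\<^sub>R b)"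
proof
  fix f
  show "v f = chart_vec U \<phi> p (\<Sum>b\<in>Basis. v (\<lambda>q. \<phi> q \<bullet> b) *\<^sub>R b) f"
  proof (cases "f \<in> smooth_near A p")
    case False
    then show ?thesis by (simp add: tangent_outside[OF v] chart_vec_def)
  next
    case f: True
    let ?h = "\<lambda>x. f (inv_into U \<phi> x)"
    obtain W where W: "open W" "p \<in> W" "smooth_fun_on A W f"
      using f unfolding smooth_near_def by blast
    have "\<phi> p \<in> \<phi> ` (U \<inter> W)" using c W by blast
    then obtain r where r: "r > 0" "ball (\<phi> p) r \<subseteq> \<phi> ` (U \<inter> W)"
      using open_chart_Int[OF c(1) W(1)] open_contains_ball by blast
    have h: "smooth_on ?h (ball (\<phi> p) r)"
      by (rule smooth_on_subset[OF smooth_fun_on_chart[OF W(3) c(1)] r(2)])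
    obtain G where G: "\<And>b. smooth_on (G b) (ball (\<phi> p) r)"
        "\<And>b. G b (\<phi> p) = frechet_derivative ?h (at (\<phi> p)) b"
        "\<And>x. x \<in> ball (\<phi> p) r \<Longrightarrow> ?h x = ?h (\<phi> p) + (\<Sum>b\<in>Basis. ((x - \<phi> p) \<bullet> b) * G b x)"
      using hadamard[OF h r(1)] by blast
    let ?V = "U \<inter> \<phi> -` ball (\<phi> p) r"
    have V: "open ?V" "p \<in> ?V"
      using chart_open_vimage[OF c(1) open_ball] c r by auto
    have Gn: "(\<lambda>q. G b (\<phi> q)) \<in> smooth_near A p" for b
      by (rule smooth_nearI[OF V smooth_fun_on_chart_compose[OF c(1) open_ball G(1)]])
    have xn: "(\<lambda>q. \<phi> q \<bullet> b - \<phi> p \<bullet> b) \<in> smooth_near A p" for b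
      using smooth_near_add[OF chart_component_near[OF c] smooth_near_const[of "- (\<phi> p \<bullet> b)"]] by simp
    have "v f = v (\<lambda>q. f p + (\<Sum>b\<in>Basis. (\<phi> q \<bullet> b - \<phi> p \<bullet> b) * G b (\<phi> q)))"
    proof (rule tangent_germ[OF v f V])
      fix q assume q: "q \<in> ?V"
      then show "f q = f p + (\<Sum>b\<in>Basis. (\<phi> q \<bullet> b - \<phi> p \<bullet> b) * G b (\<phi> q))"
        using G(3)[of "\<phi> q"] c by (simp add: chart_inv[OF c(1)] inner_diff_left)
    qed
    also have "\<dots> = (\<Sum>b\<in>Basis. v (\<lambda>q. (\<phi> q \<bullet> b - \<phi> p \<bullet> b) * G b (\<phi> q)))"
    proof -
      have s: "(\<lambda>q. \<Sum>b\<in>Basis. (\<phi> q \<bullet> b - \<phi> p \<bullet> b) * G b (\<phi> q)) \<in> smooth_near A p"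
        by (intro smooth_near_sum smooth_near_mult xn Gn)
      show ?thesis
        using tangent_add[OF v smooth_near_const s] tangent_const[OF v]
          tangent_sum[OF v, of Basis "\<lambda>b q. (\<phi> q \<bullet> b - \<phi> p \<bullet> b) * G b (\<phi> q)"]
          smooth_near_mult[OF xn Gn]
        by simp
    qed
    also have "\<dots> = (\<Sum>b\<in>Basis. v (\<lambda>q. \<phi> q \<bullet> b) * frechet_derivative ?h (at (\<phi> p)) b)"
      by (simp add: tangent_mult[OF v xn Gn] G(2) tangent_const[OF v]
          tangent_diff[OF v chart_component_near[OF c] smooth_near_const])
        (simp add: mult.commute)
    also have "\<dots> = chart_vec U \<phi> p (\<Sum>b\<in>Basis. v (\<lambda>q. \<phi> q \<bullet> b) *\<^sub>R b) f"
      using linear_expand_Basis[OF has_derivative_linear[OF near_has_derivative[OF c f]],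
          of "\<Sum>b\<in>Basis. v (\<lambda>q. \<phi> q \<bullet> b) *\<^sub>R b"] f
      by (simp add: chart_vec_def)
    finally show ?thesis .
  qed
qed

text \<open>
  The coordinate functions recover \<open>w\<close> from the derivation it defines, and every derivation arises
  in this way; so the tangent space has the dimension of the model space.
\<close>

lemma chart_vec_bij:
  assumes c: "(U, \<phi>) \<in> A" "p \<in> U"
  shows "bij_betw (chart_vec U \<phi> p) UNIV (tangent_space A p)"
proof (rule bij_betw_imageI)
  show "inj (chart_vec U \<phi> p)"
  proof (rule injI)
    fix w w' assume eq: "chart_vec U \<phi> p w = chart_vec U \<phi> p w'"
    show "w = w'"
    proof (rule euclidean_eqI)
      fix b :: 'e
      show "w \<bullet> b = w' \<bullet> b"
        using chart_vec_component[OF c, of w b] chart_vec_component[OF c, of w' b] eq by simp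
    qed
  qed
  show "range (chart_vec U \<phi> p) = tangent_space A p"
  proof (intro equalityI subsetI)
    fix v assume "v \<in> tangent_space A p"
    from tangent_in_chart[OF c this] show "v \<in> range (chart_vec U \<phi> p)" by (rule range_eqI)
  qed (auto simp: chart_vec_tangent[OF c])
qed

lemma subspace_tangent: "subspace (tangent_space A p)"
proof -
  obtain U \<phi> where c: "(U, \<phi>) \<in> A" "p \<in> U" using chart_cover[of p] by blast
  show ?thesis
    using linear_subspace_image[OF chart_vec_linear[OF c] subspace_UNIV]
      bij_betw_imp_surj_on[OF chart_vec_bij[OF c]] by simp
qed

section \<open>Vector fields\<close>

lemma vf_tangent: "X \<in> vector_fields A \<Longrightarrow> X p \<in> tangent_space A p"
  unfolding vector_fields_def by auto

lemma vf_smooth: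
  "X \<in> vector_fields A \<Longrightarrow> open W \<Longrightarrow> smooth_fun_on A W f \<Longrightarrow> smooth_fun_on A W (vapply X f)"
  unfolding vector_fields_def by auto

lemma vf_near: "X \<in> vector_fields A \<Longrightarrow> f \<in> smooth_near A p \<Longrightarrow> vapply X f \<in> smooth_near A p"
  unfolding smooth_near_def using vf_smooth by blast

lemma vapply_add: "vapply (X + Y) f = (\<lambda>q. vapply X f q + vapply Y f q)"
  by (simp add: vapply_def plus_fun_def)

lemma vf_fmult:
  assumes f: "smooth_fun_on A UNIV f" and X: "X \<in> vector_fields A"
  shows "fmult f X \<in> vector_fields A"
  unfolding vector_fields_def mem_Collect_eq
proof (intro conjI allI impI)
  fix p show "fmult f X p \<in> tangent_space A p"
    unfolding fmult_def by (rule subspace_scale[OF subspace_tangent vf_tangent[OF X]])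
next
  fix W h assume h: "open W \<and> smooth_fun_on A W h"
  have "smooth_fun_on A W (\<lambda>q. f q * vapply X h q)"
    using smooth_fun_on_mult[of W f "vapply X h"] vf_smooth[OF X, of W h] h
      smooth_fun_on_subset[OF f subset_UNIV[of W]] by blast
  moreover have "vapply (fmult f X) h = (\<lambda>q. f q * vapply X h q)"
    by (rule ext) (simp add: vapply_def fmult_def scaleR_fun_def)
  ultimately show "smooth_fun_on A W (vapply (fmult f X) h)"
    by simp
qed

lemma subspace_vf: "subspace (vector_fields A)"
proof (rule subspaceI)
  show "0 \<in> vector_fields A"
    unfolding vector_fields_def mem_Collect_eq
  proof (intro conjI allI impI)
    show "(0::'m vfield) p \<in> tangent_space A p" for p
      using subspace_0[OF subspace_tangent] by (metis zero_fun_apply)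
    have "vapply (0::'m vfield) f = (\<lambda>q. 0)" for f
      by (rule ext) (simp add: vapply_def)
    then show "smooth_fun_on A W (vapply (0::'m vfield) f)" for W f
      by (simp only: smooth_fun_on_const)
  qed
  fix X Y assume XY: "X \<in> vector_fields A" "Y \<in> vector_fields A"
  show "X + Y \<in> vector_fields A"
    unfolding vector_fields_def mem_Collect_eq vapply_add
  proof (intro conjI allI impI)
    show "(X + Y) p \<in> tangent_space A p" for p
      using subspace_add[OF subspace_tangent vf_tangent[OF XY(1)] vf_tangent[OF XY(2)]]
      by (metis plus_fun_apply)
  qed (use XY in \<open>auto intro: smooth_fun_on_add vf_smooth\<close>)
next
  fix a X assume "X \<in> vector_fields A"
  then have "fmult (\<lambda>q. a) X \<in> vector_fields A"
    by (rule vf_fmult[OF smooth_fun_on_const])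
  moreover have "fmult (\<lambda>q. a) X = a *\<^sub>R X"
    unfolding fmult_def scaleR_fun_def[of a X] ..
  ultimately show "a *\<^sub>R X \<in> vector_fields A" by simp
qed

end

section \<open>Left translations and left invariant vector fields\<close>

locale smooth_group = smooth_manifold A
  for A :: "('g::{group_add,t2_space,second_countable_topology}, 'e::euclidean_space) chart set" +
  assumes mult: "smooth_map (prod_atlas A A) A (\<lambda>(x, y). x + y)"
begin

lemma continuous_mult: "continuous_on UNIV (\<lambda>z::'g \<times> 'g. fst z + snd z)"
  using mult unfolding smooth_map_def by (simp add: case_prod_unfold)

lemma open_mult_vimage: "open W \<Longrightarrow> open {z::'g \<times> 'g. fst z + snd z \<in> W}"
  using open_vimage[OF _ continuous_mult] by (simp add: vimage_def)

lemma open_translate_vimage: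
  assumes "open W" shows "open {q::'g. a + q \<in> W}"
proof -
  have "continuous_on UNIV (\<lambda>q::'g. fst (a, q) + snd (a, q))"
    by (rule continuous_on_compose2[OF continuous_mult]) (auto intro!: continuous_intros)
  from open_vimage[OF assms this] show ?thesis by (simp add: vimage_def)
qed

lemma open_chart_prod_image:
  assumes c: "(U, \<phi>) \<in> A" "(V, \<psi>) \<in> A" and Q: "open Q" "Q \<subseteq> U \<times> V"
  shows "open (map_prod \<phi> \<psi> ` Q)"
  unfolding open_prod_def
proof (intro ballI)
  fix z assume "z \<in> map_prod \<phi> \<psi> ` Q"
  then obtain p q where pq: "(p, q) \<in> Q" "z = (\<phi> p, \<psi> q)" by auto
  obtain S T where ST: "open S" "open T" "(p, q) \<in> S \<times> T" "S \<times> T \<subseteq> Q"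
    using Q(1) pq(1) by (rule open_prod_elim)
  have sub: "S \<subseteq> U" "T \<subseteq> V" using ST Q(2) by auto
  have "z \<in> \<phi> ` S \<times> \<psi> ` T" using pq ST by auto
  moreover have "\<phi> ` S \<times> \<psi> ` T \<subseteq> map_prod \<phi> \<psi> ` Q" using ST(4) by force
  ultimately show "\<exists>A B. open A \<and> open B \<and> z \<in> A \<times> B \<and> A \<times> B \<subseteq> map_prod \<phi> \<psi> ` Q"
    using chart_open_image[OF c(1) ST(1) sub(1)] chart_open_image[OF c(2) ST(2) sub(2)] by blast
qed

definition mult_dom :: "'g set \<Rightarrow> 'g set \<Rightarrow> 'g set \<Rightarrow> ('g \<times> 'g) set"
  where "mult_dom U V W = (U \<times> V) \<inter> {z. fst z + snd z \<in> W}"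

lemma open_mult_dom:
  assumes "(U, \<phi>) \<in> A" "(V, \<psi>) \<in> A" "open W"
  shows "open (map_prod \<phi> \<psi> ` mult_dom U V W)"
  by (rule open_chart_prod_image[OF assms(1,2)])
    (auto simp: mult_dom_def intro!: open_Int open_Times chart_open[OF assms(1)] chart_open[OF assms(2)]
      open_mult_vimage assms(3))

text \<open>
  Near a given pair, \<open>f (p + q)\<close> is the multiplication read in charts around the two factors and
  around their product, followed by \<open>f\<close> read in the last of these charts.
\<close>

lemma smooth_mult_in_charts:
  assumes c: "(U, \<phi>) \<in> A" "(V, \<psi>) \<in> A" and W: "open W" "smooth_fun_on A W f"
  shows "smooth_on (\<lambda>z. f (inv_into U \<phi> (fst z) + inv_into V \<psi> (snd z))) (map_prod \<phi> \<psi> ` mult_dom U V W)"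
proof (rule smooth_on_local)
  fix z assume "z \<in> map_prod \<phi> \<psi> ` mult_dom U V W"
  then obtain p q where pq: "p \<in> U" "q \<in> V" "p + q \<in> W" "z = (\<phi> p, \<psi> q)"
    by (auto simp: mult_dom_def)
  obtain N \<kappa> where d: "(N, \<kappa>) \<in> A" "p + q \<in> N" using chart_cover[of "p + q"] by blast
  let ?S = "map_prod \<phi> \<psi> ` mult_dom U V (N \<inter> W)"
  let ?m = "\<lambda>z. \<kappa> (inv_into U \<phi> (fst z) + inv_into V \<psi> (snd z))"
  have oNW: "open (N \<inter> W)" using chart_open(1)[OF d(1)] W(1) by blast
  have oS: "open ?S" by (rule open_mult_dom[OF c oNW])
  have pr: "(U \<times> V, map_prod \<phi> \<psi>) \<in> prod_atlas A A" using c unfolding prod_atlas_def by blast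
  have inj: "inj_on (map_prod \<phi> \<psi>) (U \<times> V)"
    using map_prod_inj_on[OF chart_open(2)[OF c(1)] chart_open(2)[OF c(2)]] .
  have inv: "inv_into (U \<times> V) (map_prod \<phi> \<psi>) (\<phi> p', \<psi> q') = (p', q')" if "p' \<in> U" "q' \<in> V" for p' q'
    using inv_into_f_f[OF inj, of "(p', q')"] that by simp
  have "smooth_on (\<kappa> \<circ> (\<lambda>(x, y). x + y) \<circ> inv_into (U \<times> V) (map_prod \<phi> \<psi>))
      (map_prod \<phi> \<psi> ` (U \<times> V \<inter> (\<lambda>(x, y). x + y) -` N))"
    using mult pr d(1) unfolding smooth_map_def by blast
  then have "smooth_on (\<kappa> \<circ> (\<lambda>(x, y). x + y) \<circ> inv_into (U \<times> V) (map_prod \<phi> \<psi>)) ?S"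
    by (rule smooth_on_subset) (auto simp: mult_dom_def)
  then have m: "smooth_on ?m ?S"
    by (rule smooth_on_cong[OF oS, rotated])
      (auto simp: mult_dom_def inv chart_inv[OF c(1)] chart_inv[OF c(2)])
  have "smooth_on (\<lambda>z. f (inv_into N \<kappa> (?m z))) ?S"
    by (rule smooth_on_compose[OF oS open_chart_Int[OF d(1) W(1)] _ m smooth_fun_on_chart[OF W(2) d(1)]])
      (auto simp: mult_dom_def chart_inv[OF c(1)] chart_inv[OF c(2)])
  then have "smooth_on (\<lambda>z. f (inv_into U \<phi> (fst z) + inv_into V \<psi> (snd z))) ?S"
    by (rule smooth_on_cong[OF oS, rotated])
      (auto simp: mult_dom_def chart_inv[OF c(1)] chart_inv[OF c(2)] chart_inv[OF d(1)])
  moreover have "z \<in> ?S" using pq d(2) by (auto simp: mult_dom_def)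
  ultimately show "\<exists>T. open T \<and> z \<in> T \<and>
      smooth_on (\<lambda>z. f (inv_into U \<phi> (fst z) + inv_into V \<psi> (snd z))) T"
    using oS by blast
qed

lemma smooth_on_Pair_const:
  assumes "open S"
  shows "smooth_on (\<lambda>x::'e. (x, b::'e)) S" "smooth_on (\<lambda>x::'e. (b::'e, x)) S"
proof -
  have 1: "smooth_on (\<lambda>x::'e. (x, 0::'e)) S" and 2: "smooth_on (\<lambda>x::'e. (0::'e, x)) S"
    by (auto intro!: smooth_on_linear[OF _ assms] bounded_linear_Pair bounded_linear_ident
        bounded_linear_zero)
  show "smooth_on (\<lambda>x::'e. (x, b::'e)) S"
    using smooth_on_add[OF assms 1 smooth_on_const[of "(0, b)"]] by simp
  show "smooth_on (\<lambda>x::'e. (b::'e, x)) S"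
    using smooth_on_add[OF assms 2 smooth_on_const[of "(b, 0)"]] by simp
qed

lemma smooth_fun_on_translate:
  assumes W: "open W" "smooth_fun_on A W f"
  shows "smooth_fun_on A {q. a + q \<in> W} (\<lambda>q. f (a + q))"
proof (rule smooth_fun_on_local[OF open_translate_vimage[OF W(1)]])
  fix q assume "q \<in> {q. a + q \<in> W}"
  then have q: "a + q \<in> W" by simp
  obtain U \<phi> where c: "(U, \<phi>) \<in> A" "a \<in> U" using chart_cover[of a] by blast
  obtain V \<psi> where d: "(V, \<psi>) \<in> A" "q \<in> V" using chart_cover[of q] by blast
  let ?N = "V \<inter> {q. a + q \<in> W}"
  have N: "open ?N" using chart_open(1)[OF d(1)] open_translate_vimage[OF W(1)] by blast
  have oN: "open (\<psi> ` ?N)" by (rule chart_open_image[OF d(1) N]) auto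
  have "smooth_on (\<lambda>y. f (inv_into U \<phi> (fst (\<phi> a, y)) + inv_into V \<psi> (snd (\<phi> a, y)))) (\<psi> ` ?N)"
    by (rule smooth_on_compose[OF oN open_mult_dom[OF c(1) d(1) W(1)] _ smooth_on_Pair_const(2)[OF oN]
          smooth_mult_in_charts[OF c(1) d(1) W]])
      (use c in \<open>auto simp: mult_dom_def image_iff intro!: bexI[of _ "(a, _)"]\<close>)
  then have "smooth_fun_on A ?N (\<lambda>q. f (a + q))"
    by (intro smooth_fun_onI[OF d(1) N]) (auto simp: chart_inv[OF c])
  then show "\<exists>N. open N \<and> q \<in> N \<and> smooth_fun_on A N (\<lambda>q. f (a + q))"
    using N q d(2) by blast
qed

lemma near_translate_imp:
  assumes "f \<in> smooth_near A (a + p)"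
  shows "(\<lambda>q. f (a + q)) \<in> smooth_near A p"
proof -
  obtain W where "open W" "a + p \<in> W" "smooth_fun_on A W f"
    using assms unfolding smooth_near_def by blast
  then show ?thesis
    by (intro smooth_nearI[OF open_translate_vimage _ smooth_fun_on_translate]) auto
qed

text \<open>
  The converse direction is translation by \<open>- a\<close>.
\<close>

lemma near_translate: "(\<lambda>q. f (a + q)) \<in> smooth_near A p \<longleftrightarrow> f \<in> smooth_near A (a + p)"
proof
  assume "(\<lambda>q. f (a + q)) \<in> smooth_near A p"
  then have "(\<lambda>q. f (a + q)) \<in> smooth_near A (- a + (a + p))" by (simp add: add.assoc[symmetric])
  from near_translate_imp[OF this] show "f \<in> smooth_near A (a + p)"
    by (simp add: add.assoc[symmetric])
qed (rule near_translate_imp)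

lemma ltrans_tvec_tangent:
  assumes "v \<in> tangent_space A p"
  shows "ltrans_tvec a v \<in> tangent_space A (a + p)"
  using assms unfolding tangent_space_def mem_Collect_eq ltrans_tvec_def
  by (simp add: near_translate[symmetric] plus_fun_def times_fun_def scaleR_fun_def)

lemma ltrans_tvec_plus: "ltrans_tvec a (ltrans_tvec b v) = ltrans_tvec (a + b) v"
  by (simp add: ltrans_tvec_def add.assoc)

lemma ltrans_tvec_zero: "ltrans_tvec 0 v = v"
  by (simp add: ltrans_tvec_def)

lemma ltrans_tvec_bij: "bij_betw (ltrans_tvec a) (tangent_space A p) (tangent_space A (a + p))"
proof (rule bij_betw_byWitness[where f' = "ltrans_tvec (- a)"])
  show "ltrans_tvec (- a) ` tangent_space A (a + p) \<subseteq> tangent_space A p"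
    using ltrans_tvec_tangent[of _ "a + p" "- a"] by (auto simp: add.assoc[symmetric])
qed (auto simp: ltrans_tvec_plus ltrans_tvec_zero intro: ltrans_tvec_tangent)

definition left_field :: "'g tvec \<Rightarrow> 'g vfield"
  where "left_field v = (\<lambda>p. ltrans_tvec p v)"

text \<open>
  In charts, the derivative of \<open>f\<close> along the left invariant field is the partial derivative of
  \<open>(p, q) \<mapsto> f (p + q)\<close> in the second variable at the unit, hence smooth in \<open>p\<close>.
\<close>

lemma left_field_smooth:
  assumes v: "v \<in> tangent_space A 0" and W: "open W" "smooth_fun_on A W f"
  shows "smooth_fun_on A W (vapply (left_field v) f)"
proof (rule smooth_fun_on_local[OF W(1)])
  fix p assume p: "p \<in> W"
  obtain U \<phi> where c: "(U, \<phi>) \<in> A" "p \<in> U" using chart_cover[of p] by blast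
  obtain V \<psi> where d: "(V, \<psi>) \<in> A" "0 \<in> V" using chart_cover[of 0] by blast
  obtain w where w: "v = chart_vec V \<psi> 0 w" using tangent_in_chart[OF d v] by blast
  let ?F = "\<lambda>z. f (inv_into U \<phi> (fst z) + inv_into V \<psi> (snd z))"
  let ?S = "map_prod \<phi> \<psi> ` mult_dom U V W"
  let ?X = "\<phi> ` (U \<inter> W)"
  have F: "smooth_on ?F ?S" by (rule smooth_mult_in_charts[OF c(1) d(1) W])
  have oS: "open ?S" by (rule open_mult_dom[OF c(1) d(1) W(1)])
  have oX: "open ?X" by (rule open_chart_Int[OF c(1) W(1)])
  have XS: "(\<phi> q, \<psi> 0) \<in> ?S" if "q \<in> U" "q \<in> W" for q
    using that d(2) by (auto simp: mult_dom_def image_iff intro!: bexI[of _ "(q, 0)"])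
  have sm: "smooth_on (\<lambda>x. frechet_derivative ?F (at (x, \<psi> 0)) (0, w)) ?X"
    by (rule smooth_on_compose[OF oX oS _ smooth_on_Pair_const(1)[OF oX] smooth_on_deriv[OF F]])
      (use XS in auto)
  have eq: "frechet_derivative ?F (at (\<phi> q, \<psi> 0)) (0, w) = vapply (left_field v) f q"
    if q: "q \<in> U" "q \<in> W" for q
  proof -
    have "((\<lambda>y. (\<phi> q, y)) has_derivative (\<lambda>y. (0, y))) (at (\<psi> 0))"
      by (auto intro!: derivative_eq_intros)
    from diff_chain_at[OF this smooth_on_has_derivative[OF F XS[OF q]]]
    have "((\<lambda>y. f (q + inv_into V \<psi> y)) has_derivative
        (\<lambda>y. frechet_derivative ?F (at (\<phi> q, \<psi> 0)) (0, y))) (at (\<psi> 0))"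
      using q by (simp add: o_def chart_inv[OF c(1)])
    from fun_cong[OF frechet_derivative_at[OF this], of w]
    have "frechet_derivative (\<lambda>y. f (q + inv_into V \<psi> y)) (at (\<psi> 0)) w =
        frechet_derivative ?F (at (\<phi> q, \<psi> 0)) (0, w)" by (rule sym)
    moreover have "(\<lambda>r. f (q + r)) \<in> smooth_near A 0"
      using smooth_nearI[OF W(1) q(2) W(2)] by (simp add: near_translate)
    ultimately show ?thesis
      by (simp add: vapply_def left_field_def ltrans_tvec_def w chart_vec_def)
  qed
  have "smooth_fun_on A (U \<inter> W) (vapply (left_field v) f)"
  proof (rule smooth_fun_onI[OF c(1)])
    show "smooth_on (\<lambda>x. vapply (left_field v) f (inv_into U \<phi> x)) ?X"
      by (rule smooth_on_cong[OF oX _ sm]) (use eq in \<open>auto simp: chart_inv[OF c(1)]\<close>)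
  qed (use chart_open(1)[OF c(1)] W(1) in auto)
  then show "\<exists>N. open N \<and> p \<in> N \<and> smooth_fun_on A N (vapply (left_field v) f)"
    using p c chart_open(1)[OF c(1)] W(1) by blast
qed

lemma left_field_lie_algebra:
  assumes v: "v \<in> tangent_space A 0"
  shows "left_field v \<in> lie_algebra A"
proof -
  have "left_field v p \<in> tangent_space A p" for p
    using ltrans_tvec_tangent[OF v, of p] by (simp add: left_field_def)
  then have "left_field v \<in> vector_fields A"
    using left_field_smooth[OF v] unfolding vector_fields_def by blast
  moreover have "ltrans_vfield a (left_field v) = left_field v" for a
    by (rule ext) (simp add: ltrans_vfield_def left_field_def ltrans_tvec_plus add.assoc[symmetric])
  ultimately show ?thesis unfolding lie_algebra_def by blast
qed

lemma lie_algebra_left_field: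
  assumes "X \<in> lie_algebra A"
  shows "X = left_field (X 0)"
proof
  fix p
  have "X p = ltrans_vfield p X p" using assms unfolding lie_algebra_def by simp
  then show "X p = left_field (X 0) p" by (simp add: ltrans_vfield_def left_field_def)
qed

lemma left_field_zero: "left_field v 0 = v"
  by (simp add: left_field_def ltrans_tvec_zero)

text \<open>
  A left invariant field is determined by its value at the unit, and every tangent vector there
  extends to one because the multiplication is smooth; this computes the dimension of the Lie
  algebra.
\<close>

lemma left_field_bij: "bij_betw left_field (tangent_space A 0) (lie_algebra A)"
proof (rule bij_betw_byWitness[where f' = "\<lambda>X. X 0"])
  show "(\<lambda>X. X 0) ` lie_algebra A \<subseteq> tangent_space A 0"
    unfolding lie_algebra_def using vf_tangent by blast
qed (auto simp: lie_algebra_left_field[symmetric] left_field_lie_algebra left_field_zero)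

lemma linear_left_field: "linear left_field"
  by (rule linearI)
    (auto simp: left_field_def plus_fun_def scaleR_fun_def ltrans_tvec_def)

lemma lie_algebra_vf: "X \<in> lie_algebra A \<Longrightarrow> X \<in> vector_fields A"
  unfolding lie_algebra_def by blast

end

section \<open>Orthonormal left invariant frames\<close>

text \<open>Gram--Schmidt, applied to the standard basis and to an arbitrary inner product \<open>B\<close>.\<close>

lemma gram_schmidt:
  fixes B :: "'e::euclidean_space \<Rightarrow> 'e \<Rightarrow> real"
  assumes bil: "bilinear B" and sym: "\<And>x y. B x y = B y x" and pos: "\<And>x. x \<noteq> 0 \<Longrightarrow> B x x > 0"
  shows "\<exists>L :: 'e \<Rightarrow> 'e. linear L \<and> bij L \<and> (\<forall>x y. B (L x) (L y) = x \<bullet> y)"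
proof -
  note B = bilinear_ladd[OF bil] bilinear_radd[OF bil] bilinear_lsub[OF bil] bilinear_rsub[OF bil]
    bilinear_lmul[OF bil] bilinear_rmul[OF bil]
  have lin1: "linear (\<lambda>x. B x y)" and lin2: "linear (B x)" for x y
    using bil unfolding bilinear_def by auto
  have "\<exists>f. (\<forall>i\<in>S. f i \<in> span S) \<and> (\<forall>i\<in>S. \<forall>j\<in>S. B (f i) (f j) = (if i = j then 1 else 0))"
    if "finite S" "S \<subseteq> Basis" for S :: "'e set"
    using that
  proof (induction S rule: finite_induct)
    case (insert b S)
    obtain f where f: "\<forall>i\<in>S. f i \<in> span S"
      "\<forall>i\<in>S. \<forall>j\<in>S. B (f i) (f j) = (if i = j then 1 else 0)" using insert by auto
    define u where "u = b - (\<Sum>i\<in>S. B b (f i) *\<^sub>R f i)"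
    have "independent (insert b S)"
      using independent_mono[OF independent_Basis insert.prems] .
    then have "b \<notin> span S" using insert.hyps independent_insert by metis
    moreover have s: "(\<Sum>i\<in>S. B b (f i) *\<^sub>R f i) \<in> span S"
      using f(1) by (intro span_sum span_scale) auto
    ultimately have "u \<noteq> 0" unfolding u_def by auto
    then have up: "B u u > 0" by (rule pos)
    have uo: "B u (f j) = 0" if j: "j \<in> S" for j
    proof -
      have "B (\<Sum>i\<in>S. B b (f i) *\<^sub>R f i) (f j) = (\<Sum>i\<in>S. B b (f i) * B (f i) (f j))"
        by (simp add: linear_sum[OF lin1] B)
      also have "\<dots> = (\<Sum>i\<in>S. if i = j then B b (f i) else 0)"
        by (rule sum.cong) (use f(2) j in auto)
      also have "\<dots> = B b (f j)" using insert.hyps j by simp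
      finally show ?thesis unfolding u_def by (simp add: B)
    qed
    define f' where "f' = f(b := (1 / sqrt (B u u)) *\<^sub>R u)"
    have mono: "span S \<subseteq> span (insert b S)" by (rule span_mono) auto
    have us: "u \<in> span (insert b S)"
      unfolding u_def by (rule span_diff[OF span_base subsetD[OF mono s]]) simp
    have "f' i \<in> span (insert b S)" if "i \<in> insert b S" for i
    proof (cases "i = b")
      case True
      then show ?thesis using span_scale[OF us] by (simp add: f'_def)
    next
      case False
      then show ?thesis using that f(1) mono by (auto simp: f'_def)
    qed
    moreover have "B (f' i) (f' j) = (if i = j then 1 else 0)" if "i \<in> insert b S" "j \<in> insert b S" for i j
    proof -
      have uo': "B (f k) u = 0" if "k \<in> S" for k using uo[OF that] sym[of "f k" u] by simp
      have uu: "B u u / (sqrt (B u u) * sqrt (B u u)) = 1" using up by simp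
      show ?thesis
        using that f(2) uo uo' uu insert.hyps(2) by (auto simp: f'_def B)
    qed
    ultimately show ?case by blast
  qed simp
  from this[of Basis] obtain f :: "'e \<Rightarrow> 'e" where
    f: "\<forall>i\<in>Basis. \<forall>j\<in>Basis. B (f i) (f j) = (if i = j then 1 else 0)" by auto
  define L where "L x = (\<Sum>i\<in>Basis. (x \<bullet> i) *\<^sub>R f i)" for x
  have lin: "linear L"
    unfolding L_def by (intro linearI)
      (auto simp: inner_add_left scaleR_add_left sum.distrib scaleR_sum_right)
  have iso: "B (L x) (L y) = x \<bullet> y" for x y
  proof -
    have "B (L x) (L y) = (\<Sum>i\<in>Basis. (x \<bullet> i) * B (f i) (L y))"
      unfolding L_def[of x] by (simp add: linear_sum[OF lin1] B)
    also have "\<dots> = (\<Sum>i\<in>Basis. (x \<bullet> i) * (y \<bullet> i))"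
    proof (rule sum.cong[OF refl])
      fix i :: 'e assume i: "i \<in> Basis"
      have "B (f i) (L y) = (\<Sum>j\<in>Basis. (y \<bullet> j) * B (f i) (f j))"
        unfolding L_def[of y] by (simp add: linear_sum[OF lin2] B)
      also have "\<dots> = (\<Sum>j\<in>Basis. if j = i then y \<bullet> j else 0)"
        by (rule sum.cong) (use f i in auto)
      also have "\<dots> = y \<bullet> i" using i by simp
      finally show "(x \<bullet> i) * B (f i) (L y) = (x \<bullet> i) * (y \<bullet> i)" by simp
    qed
    also have "\<dots> = x \<bullet> y" by (rule euclidean_inner[symmetric])
    finally show ?thesis .
  qed
  have "inj L"
  proof (rule linear_injective_0[OF lin, THEN iffD2], intro allI impI)
    fix x assume "L x = 0"
    then have "x \<bullet> x = 0" using iso[of x x] linear_0[OF lin2] by simp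
    then show "x = 0" by simp
  qed
  then have "bij L" using linear_injective_imp_surjective[OF lin] by (simp add: bij_def)
  then show ?thesis using lin iso by blast
qed

context smooth_group
begin

text \<open>
  The frame is obtained by left translating an orthonormal basis of the tangent space at the unit.
  It is recorded as a linear parametrisation \<open>\<Phi>\<close> of the Lie algebra by the model space, so that
  the left invariant metric becomes the standard inner product.
\<close>

lemma orthonormal_left_frame:
  assumes g: "riemannian_metric A g" "left_invariant_metric A g"
  obtains \<Phi> :: "'e \<Rightarrow> 'g vfield" where "linear \<Phi>" "bij_betw \<Phi> UNIV (lie_algebra A)"
    "\<And>x y. metric_apply g (\<Phi> x) (\<Phi> y) = (\<lambda>p. x \<bullet> y)"
    "\<And>p. bij_betw (\<lambda>x. \<Phi> x p) UNIV (tangent_space A p)"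
proof -
  obtain V \<psi> where d: "(V, \<psi>) \<in> A" "0 \<in> V" using chart_cover[of 0] by blast
  let ?T = "chart_vec V \<psi> 0"
  note bij = chart_vec_bij[OF d] and lin = chart_vec_linear[OF d] and T = chart_vec_tangent[OF d]
  have g_add: "g p (u + v) w = g p u w + g p v w"
    and g_scale: "g p (c *\<^sub>R u) v = c * g p u v" and g_sym: "g p u v = g p v u"
    and g_pos: "u \<noteq> 0 \<Longrightarrow> g p u u > 0"
    if "u \<in> tangent_space A p" "v \<in> tangent_space A p" "w \<in> tangent_space A p" for p u v w c
    using g(1) that unfolding riemannian_metric_def by blast+
  define B where "B x y = g 0 (?T x) (?T y)" for x y
  have sym: "B x y = B y x" for x y
    unfolding B_def by (rule g_sym[OF T T T])
  have l1: "linear (\<lambda>x. B x y)" for y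
    unfolding B_def by (rule linearI) (simp_all add: linear_add[OF lin] linear_cmul[OF lin] g_add[OF T T T] g_scale[OF T T T])
  have bil: "bilinear B"
    unfolding bilinear_def
  proof (intro conjI allI l1)
    have e: "B x = (\<lambda>y. B y x)" for x by (rule ext) (rule sym)
    show "linear (B x)" for x by (subst e) (rule l1)
  qed
  have pos: "B x x > 0" if "x \<noteq> 0" for x
  proof -
    have "?T x \<noteq> 0"
      using inj_eq[OF bij_betw_imp_inj_on[OF bij], of x 0] that by (simp add: linear_0[OF lin])
    then show ?thesis unfolding B_def by (rule g_pos[OF T T T])
  qed
  obtain L :: "'e \<Rightarrow> 'e" where L: "linear L" "bij L" "\<forall>x y. B (L x) (L y) = x \<bullet> y"
    using gram_schmidt[of B, OF bil sym] pos by metis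
  define \<Phi> where "\<Phi> x = left_field (?T (L x))" for x
  have bijT: "bij_betw (\<lambda>x. ?T (L x)) UNIV (tangent_space A 0)"
    using bij_betw_trans[OF L(2) bij] by (simp add: o_def)
  show thesis
  proof (rule that[of \<Phi>])
    show "linear \<Phi>"
      unfolding \<Phi>_def using linear_compose[OF linear_compose[OF L(1) lin] linear_left_field]
      by (simp add: o_def)
    show "bij_betw \<Phi> UNIV (lie_algebra A)"
      using bij_betw_trans[OF bijT left_field_bij] unfolding \<Phi>_def by (simp add: o_def)
    show "metric_apply g (\<Phi> x) (\<Phi> y) = (\<lambda>p. x \<bullet> y)" for x y
    proof
      fix p
      have "g (p + 0) (ltrans_tvec p (?T (L x))) (ltrans_tvec p (?T (L y))) = g 0 (?T (L x)) (?T (L y))"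
        using g(2) T unfolding left_invariant_metric_def by blast
      then show "metric_apply g (\<Phi> x) (\<Phi> y) p = x \<bullet> y"
        by (simp add: metric_apply_def \<Phi>_def left_field_def L(3)[rule_format, unfolded B_def])
    qed
    show "bij_betw (\<lambda>x. \<Phi> x p) UNIV (tangent_space A p)" for p
      using bij_betw_trans[OF bijT ltrans_tvec_bij[of p 0]]
      unfolding \<Phi>_def left_field_def by (simp add: o_def)
  qed
qed

end

section \<open>Connections in a left invariant frame\<close>

lemma sum_fun_apply: "(\<Sum>i\<in>I. F i) p = (\<Sum>i\<in>I. F i p)"
  by (induction I rule: infinite_finite_induct) auto

text \<open>
  A left invariant statistical structure together with an identification \<open>\<Phi>\<close> of the Lie algebra
  with a Euclidean space that turns the metric into the standard inner product.
\<close>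

locale statistical_frame = smooth_group A
  for A :: "('g::{group_add,t2_space,second_countable_topology}, 'e::euclidean_space) chart set" +
  fixes g :: "'g metric" and D :: "'g connection" and \<Phi> :: "'e \<Rightarrow> 'g vfield"
  assumes invariant: "left_invariant_statistical_structure A g D"
    and frame_linear: "linear \<Phi>"
    and frame_bij: "bij_betw \<Phi> UNIV (lie_algebra A)"
    and frame_metric: "metric_apply g (\<Phi> x) (\<Phi> y) = (\<lambda>p. x \<bullet> y)"
    and frame_at: "bij_betw (\<lambda>x. \<Phi> x p) UNIV (tangent_space A p)"
begin

lemma frame_lie: "\<Phi> x \<in> lie_algebra A"
  using frame_bij bij_betwE by blast

lemma frame_vf: "\<Phi> x \<in> vector_fields A"
  by (rule lie_algebra_vf[OF frame_lie])

lemma frame_eq_iff: "\<Phi> x = \<Phi> y \<longleftrightarrow> x = y"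
  using inj_eq[OF bij_betw_imp_inj_on[OF frame_bij]] .

lemma riem: "riemannian_metric A g" and lin_conn: "linear_connection A D"
  and torsion: "torsion_free A D" and left_conn: "left_invariant_connection A D"
  using invariant unfolding left_invariant_statistical_structure_def statistical_structure_def by auto

abbreviation G where "G \<equiv> metric_apply g"

lemma G_sym: "X \<in> vector_fields A \<Longrightarrow> Y \<in> vector_fields A \<Longrightarrow> G X Y p = G Y X p"
  using riem vf_tangent unfolding riemannian_metric_def metric_apply_def by blast

lemma G_add:
  assumes "X \<in> vector_fields A" "Y \<in> vector_fields A" "Z \<in> vector_fields A"
  shows "G (X + Y) Z p = G X Z p + G Y Z p"
proof -
  have "g p (X p + Y p) (Z p) = g p (X p) (Z p) + g p (Y p) (Z p)"
    using riem vf_tangent assms unfolding riemannian_metric_def by blast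
  then show ?thesis by (simp add: metric_apply_def)
qed

lemma G_fmult:
  assumes "X \<in> vector_fields A" "Z \<in> vector_fields A"
  shows "G (fmult f X) Z p = f p * G X Z p"
proof -
  have "g p (f p *\<^sub>R X p) (Z p) = f p * g p (X p) (Z p)"
    using riem vf_tangent assms unfolding riemannian_metric_def by blast
  then show ?thesis by (simp add: metric_apply_def fmult_def)
qed

lemmas vf_add = subspace_add[OF subspace_vf] and vf_diff = subspace_diff[OF subspace_vf]
  and vf_zero = subspace_0[OF subspace_vf]

lemma G_diff:
  assumes "X \<in> vector_fields A" "Y \<in> vector_fields A" "Z \<in> vector_fields A"
  shows "G (X - Y) Z p = G X Z p - G Y Z p"
  using G_add[OF vf_diff[OF assms(1,2)] assms(2,3), of p] by simp

lemma G_smooth: "X \<in> vector_fields A \<Longrightarrow> Y \<in> vector_fields A \<Longrightarrow> smooth_fun_on A UNIV (G X Y)"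
  using riem unfolding riemannian_metric_def by blast

lemma G_near: "X \<in> vector_fields A \<Longrightarrow> Y \<in> vector_fields A \<Longrightarrow> G X Y \<in> smooth_near A p"
  by (rule smooth_nearI[OF open_UNIV UNIV_I G_smooth])

lemma G_definite:
  assumes "X \<in> vector_fields A" "\<And>p. G X X p = 0"
  shows "X = 0"
proof
  fix p
  have "X p = 0"
  proof (rule ccontr)
    assume "X p \<noteq> 0"
    then have "g p (X p) (X p) > 0"
      using riem vf_tangent[OF assms(1)] unfolding riemannian_metric_def by blast
    then show False using assms(2)[of p] by (simp add: metric_apply_def)
  qed
  then show "X p = 0 p" by (simp only: zero_fun_apply)
qed

lemma vf_eqI:
  assumes "X \<in> vector_fields A" "Y \<in> vector_fields A"
    and "\<And>Z p. Z \<in> vector_fields A \<Longrightarrow> G X Z p = G Y Z p"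
  shows "X = Y"
proof -
  have "X - Y = 0"
    by (rule G_definite[OF vf_diff[OF assms(1,2)]])
      (simp add: G_diff[OF assms(1,2) vf_diff[OF assms(1,2)]] assms(3)[OF vf_diff[OF assms(1,2)]])
  then show ?thesis by simp
qed

lemma frame_expand:
  assumes X: "X \<in> vector_fields A"
  shows "X = (\<Sum>b\<in>Basis. fmult (G X (\<Phi> b)) (\<Phi> b))"
proof
  fix p
  obtain x where x: "X p = \<Phi> x p"
    using bij_betw_imp_surj_on[OF frame_at[of p]] vf_tangent[OF X, of p] by blast
  have c: "G X (\<Phi> b) p = x \<bullet> b" for b
    using fun_cong[OF frame_metric[of x b], of p] x by (simp add: metric_apply_def)
  have "X p = (\<Sum>b\<in>Basis. (x \<bullet> b) *\<^sub>R \<Phi> b) p"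
    using linear_expand_Basis[OF frame_linear, of x] x by simp
  also have "\<dots> = (\<Sum>b\<in>Basis. (x \<bullet> b) *\<^sub>R \<Phi> b p)"
    by (simp add: sum_fun_apply scaleR_fun_def[where f = "\<Phi> _"])
  finally show "X p = (\<Sum>b\<in>Basis. fmult (G X (\<Phi> b)) (\<Phi> b)) p"
    by (simp add: sum_fun_apply fmult_def c)
qed

text \<open>
  Every field is a combination of the frame with smooth coefficients, which a function-linear form
  lets through.
\<close>

lemma tensor_expand:
  fixes T :: "'g vfield \<Rightarrow> 'g \<Rightarrow> real"
  assumes add: "\<And>X Y p. X \<in> vector_fields A \<Longrightarrow> Y \<in> vector_fields A \<Longrightarrow> T (X + Y) p = T X p + T Y p"
    and scale: "\<And>f X p. smooth_fun_on A UNIV f \<Longrightarrow> X \<in> vector_fields A \<Longrightarrow> T (fmult f X) p = f p * T X p"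
    and X: "X \<in> vector_fields A"
  shows "T X p = (\<Sum>b\<in>Basis. G X (\<Phi> b) p * T (\<Phi> b) p)"
proof -
  have T0: "T 0 p = 0" using add[OF vf_zero vf_zero, of p] by simp
  have sum: "T (\<Sum>i\<in>I. V i) p = (\<Sum>i\<in>I. T (V i) p)"
    if "\<And>i. V i \<in> vector_fields A" for V and I :: "'e set"
  proof (induction I rule: infinite_finite_induct)
    case (insert i I)
    have v: "sum V I \<in> vector_fields A" by (rule subspace_sum[OF subspace_vf that])
    show ?case
      using insert add[OF that v, of i p] by (simp only: sum.insert[OF insert.hyps(1,2)])
  qed (simp_all only: sum.infinite sum.empty not_False_eq_True T0)
  have "T X p = T (\<Sum>b\<in>Basis. fmult (G X (\<Phi> b)) (\<Phi> b)) p"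
    using frame_expand[OF X] by simp
  also have "\<dots> = (\<Sum>b\<in>Basis. T (fmult (G X (\<Phi> b)) (\<Phi> b)) p)"
    by (rule sum[OF vf_fmult[OF G_smooth[OF X frame_vf] frame_vf]])
  also have "\<dots> = (\<Sum>b\<in>Basis. G X (\<Phi> b) p * T (\<Phi> b) p)"
    by (simp add: scale[OF G_smooth[OF X frame_vf] frame_vf])
  finally show ?thesis .
qed

lemma D_vf: "X \<in> vector_fields A \<Longrightarrow> Y \<in> vector_fields A \<Longrightarrow> D X Y \<in> vector_fields A"
  and D_add: "X \<in> vector_fields A \<Longrightarrow> X' \<in> vector_fields A \<Longrightarrow> Y \<in> vector_fields A \<Longrightarrow> D (X + X') Y = D X Y + D X' Y"
  and D_add2: "X \<in> vector_fields A \<Longrightarrow> X' \<in> vector_fields A \<Longrightarrow> Y \<in> vector_fields A \<Longrightarrow> D Y (X + X') = D Y X + D Y X'"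
  and D_fmult: "smooth_fun_on A UNIV f \<Longrightarrow> X \<in> vector_fields A \<Longrightarrow> Y \<in> vector_fields A \<Longrightarrow>
    D (fmult f X) Y = fmult f (D X Y)"
  and D_fmult2: "smooth_fun_on A UNIV f \<Longrightarrow> X \<in> vector_fields A \<Longrightarrow> Y \<in> vector_fields A \<Longrightarrow>
    D X (fmult f Y) = fmult (vapply X f) Y + fmult f (D X Y)"
  using lin_conn unfolding linear_connection_def by blast+

lemma vapply_fun_mult:
  assumes "X \<in> vector_fields A" "f \<in> smooth_near A p" "h \<in> smooth_near A p"
  shows "vapply X (\<lambda>q. f q * h q) p = f p * vapply X h p + h p * vapply X f p"
  unfolding vapply_def by (rule tangent_mult[OF vf_tangent[OF assms(1)] assms(2,3)])

lemma vapply_fun_add: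
  assumes "X \<in> vector_fields A" "f \<in> smooth_near A p" "h \<in> smooth_near A p"
  shows "vapply X (\<lambda>q. f q + h q) p = vapply X f p + vapply X h p"
  unfolding vapply_def by (rule tangent_add[OF vf_tangent[OF assms(1)] assms(2,3)])

lemma vapply_const: "X \<in> vector_fields A \<Longrightarrow> vapply X (\<lambda>q. c) p = 0"
  unfolding vapply_def by (rule tangent_const[OF vf_tangent])

lemma UNIV_near: "smooth_fun_on A UNIV f \<Longrightarrow> f \<in> smooth_near A p"
  by (rule smooth_nearI[OF open_UNIV UNIV_I])

lemma vapply_fmult: "vapply (fmult f X) h p = f p * vapply X h p"
  by (simp add: vapply_def fmult_def scaleR_fun_def)

section \<open>The dual connection\<close>

text \<open>
  The defining equation of the dual connection asks for \<open>G (dual X Z) Y = dual_form X Z Y\<close>. The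
  right-hand side is function-linear in \<open>Y\<close>, because the derivative terms produced by a coefficient
  function cancel; hence a field with this property exists and its components in the orthonormal
  frame are the values of the form on the frame.
\<close>

definition dual_form :: "'g vfield \<Rightarrow> 'g vfield \<Rightarrow> 'g vfield \<Rightarrow> 'g \<Rightarrow> real"
  where "dual_form X Z Y p = vapply X (G Y Z) p - G (D X Y) Z p"

definition dual :: "'g connection"
  where "dual X Z = (if X \<in> vector_fields A \<and> Z \<in> vector_fields A
    then \<Sum>b\<in>Basis. fmult (dual_form X Z (\<Phi> b)) (\<Phi> b) else 0)"

lemma G_add_fun:
  "X \<in> vector_fields A \<Longrightarrow> Y \<in> vector_fields A \<Longrightarrow> Z \<in> vector_fields A \<Longrightarrow>
    G (X + Y) Z = (\<lambda>p. G X Z p + G Y Z p)"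
  and G_add_fun2:
  "X \<in> vector_fields A \<Longrightarrow> Y \<in> vector_fields A \<Longrightarrow> Z \<in> vector_fields A \<Longrightarrow>
    G Z (X + Y) = (\<lambda>p. G Z X p + G Z Y p)"
  by (auto simp: fun_eq_iff G_add G_sym[of Z] vf_add)

lemma G_fmult_fun:
  "X \<in> vector_fields A \<Longrightarrow> Z \<in> vector_fields A \<Longrightarrow> G (fmult f X) Z = (\<lambda>p. f p * G X Z p)"
  by (auto simp: fun_eq_iff G_fmult)

lemma G_fmult2:
  assumes "smooth_fun_on A UNIV f" "X \<in> vector_fields A" "Z \<in> vector_fields A"
  shows "G Z (fmult f X) p = f p * G Z X p"
  using G_sym[OF assms(3) vf_fmult[OF assms(1,2)], of p] G_sym[OF assms(3,2), of p]
    G_fmult[OF assms(2,3), of f p] by simp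

lemma dual_form_smooth:
  assumes "X \<in> vector_fields A" "Y \<in> vector_fields A" "Z \<in> vector_fields A"
  shows "smooth_fun_on A UNIV (dual_form X Z Y)"
  using smooth_fun_on_diff[OF open_UNIV vf_smooth[OF assms(1) open_UNIV G_smooth[OF assms(2,3)]]
      G_smooth[OF D_vf[OF assms(1,2)] assms(3)]]
  by (simp add: dual_form_def[abs_def])

lemma dual_form_add:
  assumes "X \<in> vector_fields A" "Z \<in> vector_fields A" "Y \<in> vector_fields A" "Y' \<in> vector_fields A"
  shows "dual_form X Z (Y + Y') p = dual_form X Z Y p + dual_form X Z Y' p"
  using assms
  by (simp add: dual_form_def G_add_fun vapply_fun_add G_near D_add2 D_vf)

lemma dual_form_fmult:
  assumes "X \<in> vector_fields A" "Z \<in> vector_fields A" "smooth_fun_on A UNIV f" "Y \<in> vector_fields A"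
  shows "dual_form X Z (fmult f Y) p = f p * dual_form X Z Y p"
  using assms
  by (simp add: dual_form_def G_fmult_fun vapply_fun_mult G_near UNIV_near D_fmult2 D_vf G_add_fun
      vf_fmult vf_smooth algebra_simps)

lemma dual_vf:
  assumes "X \<in> vector_fields A" "Z \<in> vector_fields A"
  shows "dual X Z \<in> vector_fields A"
  using assms unfolding dual_def
  by (simp add: subspace_sum[OF subspace_vf] vf_fmult dual_form_smooth frame_vf)

lemma dual_metric:
  assumes X: "X \<in> vector_fields A" and Z: "Z \<in> vector_fields A" and Y: "Y \<in> vector_fields A"
  shows "G (dual X Z) Y p = dual_form X Z Y p"
proof -
  have v: "fmult (dual_form X Z (\<Phi> b)) (\<Phi> b) \<in> vector_fields A" for b
    by (intro vf_fmult dual_form_smooth X Z frame_vf)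
  have G0: "G 0 Y p = 0" using G_add[OF vf_zero vf_zero Y, of p] by simp
  have sum: "G (\<Sum>b\<in>I. fmult (dual_form X Z (\<Phi> b)) (\<Phi> b)) Y p =
      (\<Sum>b\<in>I. dual_form X Z (\<Phi> b) p * G (\<Phi> b) Y p)" for I :: "'e set"
  proof (induction I rule: infinite_finite_induct)
    case (insert b I)
    have s: "(\<Sum>b\<in>I. fmult (dual_form X Z (\<Phi> b)) (\<Phi> b)) \<in> vector_fields A"
      by (rule subspace_sum[OF subspace_vf v])
    show ?case
      using insert G_add[OF v s Y, of b p] by (simp only: sum.insert[OF insert.hyps(1,2)] G_fmult[OF frame_vf Y])
  qed (simp_all only: sum.infinite sum.empty not_False_eq_True G0)
  have "G (dual X Z) Y p = (\<Sum>b\<in>Basis. G Y (\<Phi> b) p * dual_form X Z (\<Phi> b) p)"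
    using X Z sum[of Basis] by (simp add: dual_def G_sym[OF Y frame_vf] mult.commute)
  also have "\<dots> = dual_form X Z Y p"
    by (rule tensor_expand[OF dual_form_add[OF X Z] dual_form_fmult[OF X Z] Y, symmetric])
  finally show ?thesis .
qed

lemma dual_linear_connection: "linear_connection A dual"
  unfolding linear_connection_def
proof (intro conjI ballI allI impI)
  fix X Z assume XZ: "X \<in> vector_fields A" "Z \<in> vector_fields A"
  show "dual X Z \<in> vector_fields A" by (rule dual_vf[OF XZ])
next
  fix X Z assume "X \<notin> vector_fields A \<or> Z \<notin> vector_fields A"
  then show "dual X Z = 0" by (auto simp: dual_def)
next
  fix X X' Z assume v: "X \<in> vector_fields A" "X' \<in> vector_fields A" "Z \<in> vector_fields A"
  show "dual (X + X') Z = dual X Z + dual X' Z"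
    by (rule vf_eqI)
      (use v in \<open>simp_all add: dual_vf vf_add G_add dual_metric dual_form_def vapply_add D_add D_vf\<close>)
  show "dual Z (X + X') = dual Z X + dual Z X'"
    by (rule vf_eqI)
      (use v in \<open>simp_all add: dual_vf vf_add G_add dual_metric dual_form_def G_add_fun2 vapply_fun_add
        G_near D_vf\<close>)
next
  fix f X Z assume v: "X \<in> vector_fields A" "Z \<in> vector_fields A" and f: "smooth_fun_on A UNIV f"
  show "dual (fmult f X) Z = fmult f (dual X Z)"
    by (rule vf_eqI)
      (use v f in \<open>simp_all add: dual_vf vf_fmult G_fmult dual_metric dual_form_def vapply_fmult D_fmult
        D_vf algebra_simps\<close>)
  have e: "G Y (fmult f Z) = (\<lambda>p. f p * G Y Z p)" if "Y \<in> vector_fields A" for Y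
    by (rule ext) (rule G_fmult2[OF f v(2) that])
  show "dual X (fmult f Z) = fmult (vapply X f) Z + fmult f (dual X Z)"
    by (rule vf_eqI)
      (use v f in \<open>simp_all add: dual_vf vf_add vf_fmult vf_smooth G_add G_fmult dual_metric dual_form_def
        e vapply_fun_mult G_near UNIV_near D_vf G_sym[of Z] algebra_simps\<close>)
qed

lemma dual_property:
  assumes "X \<in> vector_fields A" "Y \<in> vector_fields A" "Z \<in> vector_fields A"
  shows "vapply X (G Y Z) = G (D X Y) Z + G Y (dual X Z)"
  by (rule ext)
    (simp add: G_sym[OF assms(2) dual_vf[OF assms(1,3)]] dual_metric[OF assms(1,3,2)] dual_form_def)

lemma dual_connection_eq: "dual_connection A g D = dual"
  unfolding dual_connection_def
proof (rule the_equality)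
  show "linear_connection A dual \<and> (\<forall>X\<in>vector_fields A. \<forall>Y\<in>vector_fields A. \<forall>Z\<in>vector_fields A.
      vapply X (G Y Z) = G (D X Y) Z + G Y (dual X Z))"
    using dual_linear_connection dual_property by blast
next
  fix D' assume D': "linear_connection A D' \<and> (\<forall>X\<in>vector_fields A. \<forall>Y\<in>vector_fields A. \<forall>Z\<in>vector_fields A.
      vapply X (G Y Z) = G (D X Y) Z + G Y (D' X Z))"
  show "D' = dual"
  proof (intro ext)
    fix X Z :: "'g vfield"
    have "D' X Z = dual X Z"
    proof (cases "X \<in> vector_fields A \<and> Z \<in> vector_fields A")
      case True
      then have XZ: "X \<in> vector_fields A" "Z \<in> vector_fields A" by auto
      have v: "D' X Z \<in> vector_fields A" using D' XZ unfolding linear_connection_def by blast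
      show ?thesis
      proof (rule vf_eqI[OF v dual_vf[OF XZ]])
        fix Y p assume Y: "Y \<in> vector_fields A"
        have "G (D X Y) Z + G Y (D' X Z) = G (D X Y) Z + G Y (dual X Z)"
          using D' dual_property[OF XZ(1) Y XZ(2)] XZ Y by metis
        then have "G Y (D' X Z) p = G Y (dual X Z) p" by simp
        then show "G (D' X Z) Y p = G (dual X Z) Y p"
          using G_sym[OF Y v] G_sym[OF Y dual_vf[OF XZ]] by simp
      qed
    next
      case False
      then show ?thesis
        using D' dual_linear_connection unfolding linear_connection_def by metis
    qed
    then show "D' X Z p v = dual X Z p v" for p v by simp
  qed
qed

section \<open>The Levi-Civita connection\<close>

lemma nabla_metric_apply:
  "nabla_metric g D' X Y Z p = vapply X (G Y Z) p - G (D' X Y) Z p - G Y (D' X Z) p"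
  by (simp add: nabla_metric_def)

text \<open>
  The difference \<open>K\<close> of two torsion free metric connections is symmetric in its two arguments,
  while \<open>G (K X Y) Z\<close> is skew in \<open>Y\<close> and \<open>Z\<close>; a trilinear form with both symmetries vanishes.
\<close>

lemma levi_civita_eq:
  assumes metric: "\<And>X Y Z. X \<in> vector_fields A \<Longrightarrow> Y \<in> vector_fields A \<Longrightarrow> Z \<in> vector_fields A \<Longrightarrow>
    nabla_metric g D X Y Z = 0"
  shows "levi_civita A g = D"
  unfolding levi_civita_def
proof (rule the_equality)
  show "linear_connection A D \<and> torsion_free A D \<and> (\<forall>X\<in>vector_fields A. \<forall>Y\<in>vector_fields A.
      \<forall>Z\<in>vector_fields A. nabla_metric g D X Y Z = 0)"
    using lin_conn torsion metric by blast
next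
  fix D' assume D': "linear_connection A D' \<and> torsion_free A D' \<and> (\<forall>X\<in>vector_fields A.
      \<forall>Y\<in>vector_fields A. \<forall>Z\<in>vector_fields A. nabla_metric g D' X Y Z = 0)"
  have D'_vf: "D' X Y \<in> vector_fields A" if "X \<in> vector_fields A" "Y \<in> vector_fields A" for X Y
    using D' that unfolding linear_connection_def by blast
  define K where "K X Y = D X Y - D' X Y" for X Y
  have K_vf: "K X Y \<in> vector_fields A" if "X \<in> vector_fields A" "Y \<in> vector_fields A" for X Y
    unfolding K_def by (intro vf_diff D_vf D'_vf that)
  have K_sym: "K X Y = K Y X" if "X \<in> vector_fields A" "Y \<in> vector_fields A" for X Y
  proof -
    have "D X Y - D Y X = D' X Y - D' Y X"
      using D' torsion that unfolding torsion_free_def by metis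
    then show ?thesis unfolding K_def by (simp add: algebra_simps)
  qed
  have K_skew: "G (K X Y) Z p = - G (K X Z) Y p"
    if "X \<in> vector_fields A" "Y \<in> vector_fields A" "Z \<in> vector_fields A" for X Y Z p
  proof -
    have "nabla_metric g D X Y Z p = 0" "nabla_metric g D' X Y Z p = 0"
      using metric D' that by simp_all
    then show ?thesis
      using that
      by (simp add: nabla_metric_apply K_def G_diff D_vf D'_vf G_sym[of Y])
  qed
  show "D' = D"
  proof (intro ext)
    fix X Y :: "'g vfield"
    have "D' X Y = D X Y"
    proof (cases "X \<in> vector_fields A \<and> Y \<in> vector_fields A")
      case True
      then have X: "X \<in> vector_fields A" and Y: "Y \<in> vector_fields A" by auto
      have "K X Y = 0"
      proof (rule G_definite[OF K_vf[OF X Y]])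
        fix p
        let ?Z = "K X Y"
        have Z: "?Z \<in> vector_fields A" by (rule K_vf[OF X Y])
        have "G ?Z ?Z p = - G (K X ?Z) Y p" by (rule K_skew[OF X Y Z])
        also have "\<dots> = - G (K ?Z X) Y p" using K_sym[OF X Z] by simp
        also have "\<dots> = G (K ?Z Y) X p" using K_skew[OF Z X Y] by simp
        also have "\<dots> = G (K Y ?Z) X p" using K_sym[OF Z Y] by simp
        also have "\<dots> = - G (K Y X) ?Z p" by (rule K_skew[OF Y Z X])
        also have "\<dots> = - G ?Z ?Z p" using K_sym[OF Y X] by simp
        finally show "G ?Z ?Z p = 0" by simp
      qed
      then show ?thesis unfolding K_def by simp
    next
      case False
      then show ?thesis
        using D' lin_conn unfolding linear_connection_def by metis
    qed
    then show "D' X Y p v = D X Y p v" for p v by simp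
  qed
qed

end

section \<open>Reduction to the Lie algebra\<close>

text \<open>
  Whatever basis \<open>B\<close> is chosen in the definition of the trace, expanding \<open>b \<in> B\<close> in the image of the
  standard basis and exchanging the two sums reassembles \<open>\<Phi> (T' i)\<close> from its representation in \<open>B\<close>.
\<close>

lemma lin_trace_eq:
  fixes \<Phi> :: "'e::euclidean_space \<Rightarrow> 'v::real_vector"
  assumes lin: "linear \<Phi>" and bij: "bij_betw \<Phi> UNIV V" and T': "linear T'"
    and T: "\<And>x. T (\<Phi> x) = \<Phi> (T' x)"
  shows "lin_trace V T = (\<Sum>i\<in>Basis. T' i \<bullet> i)"
proof -
  have inj: "inj \<Phi>" and surj: "range \<Phi> = V" using bij unfolding bij_betw_def by auto
  have "independent (\<Phi> ` Basis)"
    using linear_independent_injective_image[OF lin independent_Basis inj_on_subset[OF inj]] by simp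
  moreover have spV: "span (\<Phi> ` Basis) = V"
    using linear_span_image[OF lin, of Basis] surj by simp
  ultimately have ex: "\<exists>B. independent B \<and> span B = V" by blast
  define B where "B = (SOME B. independent B \<and> span B = V)"
  have B: "independent B" "span B = V" using someI_ex[OF ex] unfolding B_def by auto
  have BV: "B \<subseteq> V" using span_superset[of B] B(2) by simp
  have fin: "finite B"
    using independent_span_bound[OF _ B(1), of "\<Phi> ` Basis"] BV spV by simp
  define \<psi> where "\<psi> = inv \<Phi>"
  have \<psi>: "\<Phi> (\<psi> v) = v" if "v \<in> V" for v
    using that surj by (auto simp: \<psi>_def f_inv_into_f)
  have rep: "representation B (T b) b = (\<Sum>i\<in>Basis. (\<psi> b \<bullet> i) * representation B (\<Phi> (T' i)) b)"
    if "b \<in> B" for b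
  proof -
    have "T b = \<Phi> (T' (\<psi> b))" using T[of "\<psi> b"] \<psi>[of b] that BV by auto
    also have "\<dots> = (\<Sum>i\<in>Basis. (\<psi> b \<bullet> i) *\<^sub>R \<Phi> (T' i))"
      using linear_expand_Basis[OF linear_compose[OF T' lin], of "\<psi> b"] by (simp add: o_def)
    finally have "T b = (\<Sum>i\<in>Basis. (\<psi> b \<bullet> i) *\<^sub>R \<Phi> (T' i))" .
    moreover have "\<Phi> (T' i) \<in> span B" for i using B(2) surj by auto
    ultimately show ?thesis
      by (simp add: representation_sum[OF B(1)] representation_scale[OF B(1)] span_scale)
  qed
  have "lin_trace V T = (\<Sum>b\<in>B. representation B (T b) b)"
    unfolding lin_trace_def B_def[symmetric] Let_def ..
  also have "\<dots> = (\<Sum>b\<in>B. \<Sum>i\<in>Basis. (\<psi> b \<bullet> i) * representation B (\<Phi> (T' i)) b)"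
    by (rule sum.cong[OF refl rep])
  also have "\<dots> = (\<Sum>i\<in>Basis. \<Sum>b\<in>B. (\<psi> b \<bullet> i) * representation B (\<Phi> (T' i)) b)"
    by (rule sum.swap)
  also have "\<dots> = (\<Sum>i\<in>Basis. T' i \<bullet> i)"
  proof (rule sum.cong[OF refl])
    fix i :: 'e
    have m: "\<Phi> (T' i) \<in> span B" using B(2) surj by auto
    have "\<Phi> (\<Sum>b\<in>B. representation B (\<Phi> (T' i)) b *\<^sub>R \<psi> b) =
        (\<Sum>b\<in>B. representation B (\<Phi> (T' i)) b *\<^sub>R \<Phi> (\<psi> b))"
      by (simp add: linear_sum[OF lin] linear_cmul[OF lin])
    also have "\<dots> = (\<Sum>b\<in>B. representation B (\<Phi> (T' i)) b *\<^sub>R b)"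
      by (rule sum.cong) (use \<psi> BV in auto)
    also have "\<dots> = \<Phi> (T' i)"
      by (rule sum_representation_eq[OF B(1) m fin]) simp
    finally have "(\<Sum>b\<in>B. representation B (\<Phi> (T' i)) b *\<^sub>R \<psi> b) = T' i"
      using inj by (simp add: inj_eq)
    then have "T' i \<bullet> i = (\<Sum>b\<in>B. representation B (\<Phi> (T' i)) b *\<^sub>R \<psi> b) \<bullet> i" by simp
    then show "(\<Sum>b\<in>B. (\<psi> b \<bullet> i) * representation B (\<Phi> (T' i)) b) = T' i \<bullet> i"
      by (simp add: inner_sum_left mult.commute)
  qed
  finally show ?thesis .
qed

context smooth_manifold
begin

lemma bracket_bracket:
  assumes v: "X \<in> vector_fields A" "Y \<in> vector_fields A" "Z \<in> vector_fields A"
    and f: "f \<in> smooth_near A p"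
  shows "lie_bracket A X (lie_bracket A Y Z) p f =
    X p (vapply Y (vapply Z f)) - X p (vapply Z (vapply Y f)) -
    (Y p (vapply Z (vapply X f)) - Z p (vapply Y (vapply X f)))"
proof -
  obtain W where W: "open W" "p \<in> W" "smooth_fun_on A W f"
    using f unfolding smooth_near_def by blast
  note n = vf_near[OF v(1)] vf_near[OF v(2)] vf_near[OF v(3)]
  have d: "(\<lambda>q. vapply Y (vapply Z f) q - vapply Z (vapply Y f) q) \<in> smooth_near A p"
    using smooth_near_add[OF n(2)[OF n(3)[OF f]] smooth_near_mult[OF smooth_near_const[of "-1"] n(3)[OF n(2)[OF f]]]]
    by simp
  have "X p (vapply (lie_bracket A Y Z) f) = X p (\<lambda>q. vapply Y (vapply Z f) q - vapply Z (vapply Y f) q)"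
  proof (rule tangent_germ[OF vf_tangent[OF v(1)] d W(1,2), symmetric])
    fix q assume "q \<in> W"
    then have "f \<in> smooth_near A q" using W smooth_nearI by blast
    then show "vapply Y (vapply Z f) q - vapply Z (vapply Y f) q = vapply (lie_bracket A Y Z) f q"
      by (simp add: vapply_def lie_bracket_def)
  qed
  also have "\<dots> = X p (vapply Y (vapply Z f)) - X p (vapply Z (vapply Y f))"
    by (rule tangent_diff[OF vf_tangent[OF v(1)] n(2)[OF n(3)[OF f]] n(3)[OF n(2)[OF f]]])
  finally show ?thesis
    using f n(1)[OF f] by (simp add: lie_bracket_def)
qed

text \<open>
  Applied to a function, the three double brackets are twelve third order derivatives that cancel in
  pairs; functions that are not smooth near \<open>p\<close> are sent to \<open>0\<close> by all terms.
\<close>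

lemma jacobi:
  assumes v: "X \<in> vector_fields A" "Y \<in> vector_fields A" "Z \<in> vector_fields A"
  shows "lie_bracket A X (lie_bracket A Y Z) + lie_bracket A Y (lie_bracket A Z X) +
    lie_bracket A Z (lie_bracket A X Y) = 0"
proof (intro ext)
  fix p f
  show "(lie_bracket A X (lie_bracket A Y Z) + lie_bracket A Y (lie_bracket A Z X) +
    lie_bracket A Z (lie_bracket A X Y)) p f = 0 p f"
  proof (cases "f \<in> smooth_near A p")
    case True
    then show ?thesis
      by (simp add: bracket_bracket[OF v(1,2,3)] bracket_bracket[OF v(2,3,1)] bracket_bracket[OF v(3,1,2)])
  qed (simp add: lie_bracket_def)
qed

end

context statistical_frame
begin

definition conn :: "'e \<Rightarrow> 'e \<Rightarrow> 'e" where "conn x y = inv \<Phi> (D (\<Phi> x) (\<Phi> y))"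

text \<open>
  Left invariance of \<open>D\<close> keeps the covariant derivative of left invariant fields in the Lie algebra.
\<close>

lemma frame_conn: "\<Phi> (conn x y) = D (\<Phi> x) (\<Phi> y)"
proof -
  have "ltrans_vfield a (D (\<Phi> x) (\<Phi> y)) = D (\<Phi> x) (\<Phi> y)" for a
  proof -
    have "ltrans_vfield a (D (\<Phi> x) (\<Phi> y)) = D (ltrans_vfield a (\<Phi> x)) (ltrans_vfield a (\<Phi> y))"
      using left_conn frame_vf unfolding left_invariant_connection_def by blast
    moreover have "ltrans_vfield a (\<Phi> z) = \<Phi> z" for z
      using frame_lie unfolding lie_algebra_def by blast
    ultimately show ?thesis by simp
  qed
  then have "D (\<Phi> x) (\<Phi> y) \<in> lie_algebra A"
    unfolding lie_algebra_def using D_vf[OF frame_vf frame_vf] by blast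
  then have "D (\<Phi> x) (\<Phi> y) \<in> range \<Phi>"
    using bij_betw_imp_surj_on[OF frame_bij] by simp
  then show ?thesis unfolding conn_def by (rule f_inv_into_f)
qed

lemma fmult_const: "fmult (\<lambda>p. c) X = c *\<^sub>R X"
  by (rule ext) (simp add: fmult_def scaleR_fun_def[of c X])

lemmas frame_add = linear_add[OF frame_linear] and frame_scale = linear_cmul[OF frame_linear]
  and frame_diff = linear_diff[OF frame_linear]

lemma bilinear_conn: "bilinear conn"
proof -
  have a: "conn (x + y) z = conn x z + conn y z" "conn z (x + y) = conn z x + conn z y" for x y z
    by (rule frame_eq_iff[THEN iffD1];
        simp only: frame_add frame_conn D_add[OF frame_vf frame_vf frame_vf] D_add2[OF frame_vf frame_vf frame_vf])+
  have s1: "conn (c *\<^sub>R x) z = c *\<^sub>R conn x z" for c x z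
    using D_fmult[of "\<lambda>p. c" "\<Phi> x" "\<Phi> z"] smooth_fun_on_const frame_vf
    by (intro frame_eq_iff[THEN iffD1]) (simp only: frame_scale frame_conn fmult_const)
  have s2: "conn z (c *\<^sub>R x) = c *\<^sub>R conn z x" for c x z
  proof (rule frame_eq_iff[THEN iffD1])
    have "vapply (\<Phi> z) (\<lambda>q. c) = (\<lambda>p. 0)"
      by (rule ext) (rule vapply_const[OF frame_vf])
    then have "D (\<Phi> z) (c *\<^sub>R \<Phi> x) = c *\<^sub>R D (\<Phi> z) (\<Phi> x)"
      using D_fmult2[of "\<lambda>p. c" "\<Phi> z" "\<Phi> x"] smooth_fun_on_const frame_vf
      by (simp only: fmult_const scaleR_zero_left add_0 fmult_const)
    then show "\<Phi> (conn z (c *\<^sub>R x)) = \<Phi> (c *\<^sub>R conn z x)"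
      by (simp only: frame_scale frame_conn)
  qed
  show ?thesis
    unfolding bilinear_def by (intro conjI allI linearI a s1 s2)
qed

definition br :: "'e \<Rightarrow> 'e \<Rightarrow> 'e" where "br x y = conn x y - conn y x"

text \<open>
  Torsion freeness expresses the bracket by \<open>D\<close>. In particular the bracket of left invariant fields
  is again a left invariant field.
\<close>

lemma frame_br: "\<Phi> (br x y) = lie_bracket A (\<Phi> x) (\<Phi> y)"
  using torsion frame_vf unfolding br_def torsion_free_def frame_diff frame_conn by blast

lemma br_jacobi: "br x (br y z) + br y (br z x) + br z (br x y) = 0"
proof (rule frame_eq_iff[THEN iffD1])
  show "\<Phi> (br x (br y z) + br y (br z x) + br z (br x y)) = \<Phi> 0"
    using jacobi[OF frame_vf[of x] frame_vf[of y] frame_vf[of z]]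
    by (simp only: frame_add frame_br linear_0[OF frame_linear])
qed

definition cubic :: "'e \<Rightarrow> 'e \<Rightarrow> 'e \<Rightarrow> real"
  where "cubic x y z = - (conn x y \<bullet> z) - y \<bullet> conn x z"

lemma nabla_metric_frame: "nabla_metric g D (\<Phi> x) (\<Phi> y) (\<Phi> z) p = cubic x y z"
  by (simp add: nabla_metric_apply frame_conn[symmetric] frame_metric vapply_const frame_vf cubic_def)

lemma nabla_symmetric:
  assumes "X \<in> vector_fields A" "Y \<in> vector_fields A" "Z \<in> vector_fields A"
  shows "nabla_metric g D X Y Z = nabla_metric g D Y X Z" "nabla_metric g D X Y Z = nabla_metric g D X Z Y"
  using invariant assms
  unfolding left_invariant_statistical_structure_def statistical_structure_def by blast+

lemma cubic_sym: "cubic x y z = cubic y x z"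
  using nabla_symmetric(1)[OF frame_vf frame_vf frame_vf, of x y z] by (metis nabla_metric_frame)

lemma nabla_metric_expand:
  assumes X: "X \<in> vector_fields A" and Y: "Y \<in> vector_fields A" and Z: "Z \<in> vector_fields A"
  shows "nabla_metric g D X Y Z p = (\<Sum>b\<in>Basis. G X (\<Phi> b) p * nabla_metric g D (\<Phi> b) Y Z p)"
proof (rule tensor_expand[where T = "\<lambda>X. nabla_metric g D X Y Z", OF _ _ X])
  show "nabla_metric g D (X + X') Y Z p = nabla_metric g D X Y Z p + nabla_metric g D X' Y Z p"
    if "X \<in> vector_fields A" "X' \<in> vector_fields A" for X X' p
    using that Y Z by (simp add: nabla_metric_apply vapply_add D_add G_add D_vf G_add_fun2)
  show "nabla_metric g D (fmult f X) Y Z p = f p * nabla_metric g D X Y Z p"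
    if "smooth_fun_on A UNIV f" "X \<in> vector_fields A" for f X p
    using that Y Z by (simp add: nabla_metric_apply vapply_fmult D_fmult G_fmult D_vf G_fmult2 algebra_simps)
qed

text \<open>
  The form \<open>nabla_metric g D\<close> is function-linear in its first argument, hence by total symmetry in
  all three. If it vanished on the frame it would vanish identically, and \<open>D\<close>, being torsion free
  and metric, would be the Levi-Civita connection.
\<close>

lemma cubic_nonzero:
  assumes "D \<noteq> levi_civita A g"
  shows "\<exists>x y z. cubic x y z \<noteq> 0"
proof (rule ccontr)
  assume "\<nexists>x y z. cubic x y z \<noteq> 0"
  then have 0: "nabla_metric g D (\<Phi> x) (\<Phi> y) (\<Phi> z) p = 0" for x y z p
    by (simp add: nabla_metric_frame)
  have 1: "nabla_metric g D (\<Phi> x) (\<Phi> y) Z p = 0" if Z: "Z \<in> vector_fields A" for x y Z p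
    using nabla_metric_expand[OF Z frame_vf frame_vf, of x y p] 0
      nabla_symmetric(1)[OF Z frame_vf frame_vf, of x y] nabla_symmetric(2)[OF frame_vf Z frame_vf, of x y]
    by simp
  have 2: "nabla_metric g D (\<Phi> x) Y Z p = 0"
    if Y: "Y \<in> vector_fields A" and Z: "Z \<in> vector_fields A" for x Y Z p
    using nabla_metric_expand[OF Y frame_vf Z, of x p] 1[OF Z] nabla_symmetric(1)[OF Y frame_vf Z, of x]
    by simp
  have "levi_civita A g = D"
  proof (rule levi_civita_eq)
    fix X Y Z assume v: "X \<in> vector_fields A" "Y \<in> vector_fields A" "Z \<in> vector_fields A"
    show "nabla_metric g D X Y Z = 0"
      by (rule ext) (simp add: nabla_metric_expand[OF v] 2[OF v(2,3)])
  qed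
  with assms show False by simp
qed

text \<open>
  The dual connection on the Lie algebra: \<open>adj x\<close> is the negative transpose of \<open>conn x\<close>.
\<close>

definition adj :: "'e \<Rightarrow> 'e \<Rightarrow> 'e" where "adj x z = (\<Sum>b\<in>Basis. (- (conn x b \<bullet> z)) *\<^sub>R b)"

lemma adj_inner: "adj x z \<bullet> y = - (conn x y \<bullet> z)"
proof -
  have "linear (conn x)" using bilinear_conn unfolding bilinear_def by blast
  from linear_expand_Basis[OF this, of y]
  have "conn x y \<bullet> z = (\<Sum>b\<in>Basis. (y \<bullet> b) * (conn x b \<bullet> z))" by (simp add: inner_sum_left)
  then show ?thesis
    by (simp add: adj_def inner_sum_left sum_negf inner_commute[of y] mult.commute)
qed

lemma adj_adj: "adj u (adj v z) \<bullet> w = conn v (conn u w) \<bullet> z"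
  using adj_inner[of u "adj v z" w] adj_inner[of v z "conn u w"]
    inner_commute[of "conn u w" "adj v z"] by simp

lemma frame_adj: "\<Phi> (adj x z) = dual (\<Phi> x) (\<Phi> z)"
proof -
  note d = dual_vf[OF frame_vf frame_vf, of x z]
  have e: "G (dual (\<Phi> x) (\<Phi> z)) (\<Phi> y) = G (\<Phi> (adj x z)) (\<Phi> y)" for y
    by (rule ext)
      (simp add: dual_metric frame_vf dual_form_def frame_metric vapply_const frame_conn[symmetric] adj_inner)
  show ?thesis
    using frame_expand[OF d] frame_expand[OF frame_vf[of "adj x z"]] by (simp only: e)
qed

definition curv :: "'e \<Rightarrow> 'e \<Rightarrow> 'e \<Rightarrow> 'e"
  where "curv x y z = conn x (conn y z) - conn y (conn x z) - conn (br x y) z"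

text \<open>
  On left invariant fields the dual connection is \<open>- conn\<^sup>T\<close>, hence its curvature is the
  negative transpose of that of \<open>D\<close>; conjugate symmetry makes the curvature operators skew.
\<close>

lemma curv_skew:
  assumes "conjugate_symmetric A g D"
  shows "curv x y z \<bullet> w = - (curv x y w \<bullet> z)"
proof -
  have "curvature A D (\<Phi> x) (\<Phi> y) (\<Phi> z) = curvature A dual (\<Phi> x) (\<Phi> y) (\<Phi> z)"
    using assms frame_vf unfolding conjugate_symmetric_def dual_connection_eq by blast
  then have "\<Phi> (curv x y z) = \<Phi> (adj x (adj y z) - adj y (adj x z) - adj (br x y) z)"
    by (simp only: curvature_def curv_def frame_diff frame_conn frame_adj frame_br)
  then have "curv x y z \<bullet> w = (adj x (adj y z) - adj y (adj x z) - adj (br x y) z) \<bullet> w"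
    by (simp only: frame_eq_iff)
  also have "\<dots> = - (curv x y w \<bullet> z)"
    by (simp add: curv_def inner_diff_left adj_adj adj_inner[of "br x y"])
  finally show ?thesis .
qed

lemma trace_nonzero:
  assumes "\<not> unimodular A"
  shows "\<exists>x. (\<Sum>i\<in>Basis. br x i \<bullet> i) \<noteq> 0"
proof -
  obtain X where X: "X \<in> lie_algebra A" "lin_trace (lie_algebra A) (lie_bracket A X) \<noteq> 0"
    using assms unfolding unimodular_def by blast
  obtain x where x: "X = \<Phi> x" using X(1) bij_betw_imp_surj_on[OF frame_bij] by blast
  have "linear (br x)"
    using bilinear_conn unfolding br_def[abs_def] bilinear_def by (intro linear_compose_sub) auto
  then have "lin_trace (lie_algebra A) (lie_bracket A X) = (\<Sum>i\<in>Basis. br x i \<bullet> i)"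
    by (rule lin_trace_eq[OF frame_linear frame_bij]) (simp add: x frame_br)
  then show ?thesis using X(2) by metis
qed

lemma locally_isomorphicI:
  fixes T :: "real ^ 3 \<Rightarrow> 'e"
  assumes T: "linear T" "bij T" and h: "\<And>x y. T (model_bracket \<xi> \<eta> x y) = br (T x) (T y)"
  shows "locally_isomorphic_to_model A \<xi> \<eta>"
proof -
  define F where "F x = \<Phi> (T x)" for x
  have bij: "bij_betw F UNIV (lie_algebra A)"
    using bij_betw_trans[OF T(2) frame_bij] by (simp add: F_def[abs_def] o_def)
  have F: "F (x + y) = F x + F y" "F (r *\<^sub>R x) = r *\<^sub>R F x"
    "F (model_bracket \<xi> \<eta> x y) = lie_bracket A (F x) (F y)" for x y r
    by (simp_all only: F_def linear_add[OF T(1)] linear_cmul[OF T(1)] frame_add frame_scale h frame_br)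
  define J where "J = inv F"
  have J: "J (F x) = x" for x unfolding J_def using bij by (simp add: bij_betw_def)
  have ex: "\<exists>x. X = F x" if "X \<in> lie_algebra A" for X
    using that bij_betw_imp_surj_on[OF bij] by blast
  have "bij_betw J (lie_algebra A) UNIV" unfolding J_def by (rule bij_betw_inv_into[OF bij])
  moreover have "J (X + Y) = J X + J Y" "J (lie_bracket A X Y) = model_bracket \<xi> \<eta> (J X) (J Y)"
    if X: "X \<in> lie_algebra A" and Y: "Y \<in> lie_algebra A" for X Y
  proof -
    obtain x y where "X = F x" "Y = F y" using ex[OF X] ex[OF Y] by blast
    then show "J (X + Y) = J X + J Y" "J (lie_bracket A X Y) = model_bracket \<xi> \<eta> (J X) (J Y)"
      by (simp_all only: F[symmetric] J)
  qed
  moreover have "J (r *\<^sub>R X) = r *\<^sub>R J X" if X: "X \<in> lie_algebra A" for r X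
  proof -
    obtain x where "X = F x" using ex[OF X] by blast
    then show ?thesis by (simp only: F[symmetric] J)
  qed
  ultimately show ?thesis
    unfolding locally_isomorphic_to_model_def lie_algebras_isomorphic_def by blast
qed

end

section \<open>Conjugate symmetric structures on three-dimensional Lie algebras\<close>

text \<open>
  Here \<open>cijk\<close> are the components of the cubic form in an adapted orthonormal basis, in which \<open>ad e1\<close>
  acts on the plane of \<open>e2, e3\<close> with symmetric part \<open>diag (p, q)\<close> and skew part \<open>a\<close>. The equations
  say that the covariant derivative of the cubic form by the Levi-Civita connection is totally
  symmetric; the groups \<open>e23\<close>, \<open>e12\<close>, \<open>e13\<close> come from exchanging the two directions in question.
  
  Assume \<open>p \<noteq> q\<close>. Then \<open>c123 = 0\<close>, and the remaining equations decouple into one system for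
  \<open>c111, c122, c133\<close> and one for the other six unknowns, in which \<open>c112\<close> and \<open>c113\<close> control the rest.
\<close>

lemma codazzi_solution:
  fixes p q a :: real
  assumes pq: "p + q \<noteq> 0"
    and e23: "(q - p) * c123 = 0" "(q - p) * c223 = - (p * c113)" "(q - p) * c233 = q * c112"
      "q * c122 = p * c133"
    and e12: "3 * p * c112 = - (a * c113)" "p * (2 * c122 - c111) = - (2 * a * c123)" "a * (c122 - c133) = 2 * p * c123"
      "p * (c222 - 2 * c112) = - (3 * a * c223)" "p * c233 = a * (2 * c223 - c333)"
      "p * (c223 - c113) = a * (c222 - 2 * c233)"
    and e13: "3 * q * c113 = a * c112" "q * (2 * c133 - c111) = 2 * a * c123"
      "q * (c333 - 2 * c113) = 3 * a * c233" "q * c223 = - (a * (2 * c233 - c222))"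
      "q * (c233 - c112) = - (a * (c333 - 2 * c223))"
    and nz: "c111 \<noteq> 0 \<or> c112 \<noteq> 0 \<or> c113 \<noteq> 0 \<or> c122 \<noteq> 0 \<or> c123 \<noteq> 0 \<or> c133 \<noteq> 0 \<or>
      c222 \<noteq> 0 \<or> c223 \<noteq> 0 \<or> c233 \<noteq> 0 \<or> c333 \<noteq> 0"
  shows "p = q \<or> a = 0 \<and> (p = 0 \<or> q = 0)"
proof (rule ccontr)
  assume neg: "\<not> ?thesis"
  then have pq': "q - p \<noteq> 0" by simp
  have c123: "c123 = 0" using e23(1) pq' by simp
  have q1: "c122 = 0 \<and> c133 = 0 \<and> c111 = 0"
  proof (cases "p = 0")
    case True
    then have "q \<noteq> 0" "a \<noteq> 0" using pq neg by auto
    then show ?thesis using e23(4) e12(3) e13(2) c123 True by auto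
  next
    case p: False
    show ?thesis
    proof (cases "q = 0")
      case True
      then have "a \<noteq> 0" using neg by auto
      then show ?thesis using e23(4) e12(2,3) c123 True p by auto
    next
      case False
      then have "c111 = 2 * c122" "c122 = c133" using p e12(2) e13(2) e12(3) c123 by auto
      then show ?thesis using e23(4) pq' by (auto simp: algebra_simps)
    qed
  qed
  have rest: "c222 = 0 \<and> c223 = 0 \<and> c233 = 0 \<and> c333 = 0" if z: "c112 = 0" "c113 = 0"
  proof -
    have z': "c223 = 0" "c233 = 0" using e23(2,3) z pq' by auto
    have "p * c222 = 0" "a * c333 = 0" "a * c222 = 0" "q * c333 = 0"
      using e12(4,5,6) e13(3) z z' by auto
    then show ?thesis using z' neg by auto
  qed
  have "c112 = 0 \<and> c113 = 0"
  proof (cases "a = 0")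
    case True
    then show ?thesis using e12(1) e13(1) neg by auto
  next
    case a: False
    \<comment> \<open>The two equations for \<open>(c112, c113)\<close> have determinant \<open>9pq + a\<^sup>2\<close>.\<close>
    show ?thesis
    proof (cases "9 * p * q + a\<^sup>2 = 0")
      case False
      have "(9 * p * q + a\<^sup>2) * c112 = 3 * q * (3 * p * c112) + a * (a * c112)"
        by (simp add: power2_eq_square algebra_simps)
      also have "\<dots> = 0" unfolding e12(1) e13(1)[symmetric] by (simp add: algebra_simps)
      finally have "c112 = 0" using False by simp
      moreover have "a * c113 = 0" using e12(1) \<open>c112 = 0\<close> by simp
      ultimately show ?thesis using a by simp
    next
      \<comment> \<open>Otherwise \<open>c112\<close> and \<open>c113\<close> are proportional. Eliminating \<open>c222\<close>, \<open>c223\<close>, \<open>c233\<close> gives a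
        second proportionality, which contradicts the first unless both vanish.\<close>
      case True
      then have t: "p * q = - a\<^sup>2 / 9" by simp
      have p0: "p \<noteq> 0" using True a by auto
      have "a * ((q - p) * c222) = a * (2 * ((q - p) * c233)) + q * ((q - p) * c223)"
        using e13(4) by algebra
      then have c222: "a * ((q - p) * c222) = 2 * a * q * c112 - p * q * c113"
        unfolding e23(2,3) by (simp add: algebra_simps)
      have "p * (a * ((q - p) * c222) - 2 * a * ((q - p) * c112)) = - (3 * a\<^sup>2 * ((q - p) * c223))"
        using e12(4) by algebra
      then have "2 * a * p\<^sup>2 * c112 = (p * q + 3 * a\<^sup>2) * (p * c113)"
        unfolding c222 e23(2) by (simp add: power2_eq_square algebra_simps)
      moreover have "(p * q + 3 * a\<^sup>2) * (p * c113) = (26 / 9) * (a\<^sup>2 * (p * c113))"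
        unfolding t by (simp add: algebra_simps)
      moreover have "3 * (2 * a * p\<^sup>2 * c112) = - 2 * (a\<^sup>2 * (p * c113))"
        using e12(1) by algebra
      ultimately have "a\<^sup>2 * (p * c113) = 0" by linarith
      then have "c113 = 0" using a p0 by simp
      then show ?thesis using e12(1) p0 by simp
    qed
  qed
  then show False using nz q1 c123 rest by blast
qed

lemma orthonormal_expand:
  fixes e1 e2 e3 x :: "real ^ 3"
  assumes "norm e1 = 1" "norm e2 = 1" "norm e3 = 1" "e1 \<bullet> e2 = 0" "e1 \<bullet> e3 = 0" "e2 \<bullet> e3 = 0"
  shows "x = (x \<bullet> e1) *\<^sub>R e1 + (x \<bullet> e2) *\<^sub>R e2 + (x \<bullet> e3) *\<^sub>R e3"
proof -
  have n: "e1 \<bullet> e1 = 1" "e2 \<bullet> e2 = 1" "e3 \<bullet> e3 = 1"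
    using assms(1-3) by (simp_all add: norm_eq_1)
  have ne: "e1 \<noteq> e2" "e1 \<noteq> e3" "e2 \<noteq> e3" "e1 \<noteq> 0" "e2 \<noteq> 0" "e3 \<noteq> 0"
    using n assms(4-6) by auto
  let ?B = "{e1, e2, e3}"
  have ind: "independent ?B"
    by (rule pairwise_orthogonal_independent)
      (use assms ne in \<open>auto simp: pairwise_def orthogonal_def inner_commute\<close>)
  have "card ?B = 3" using ne by simp
  then have "UNIV \<subseteq> span ?B"
    using card_ge_dim_independent[OF subset_UNIV ind] by simp
  then have "x \<in> span ?B" by blast
  then obtain a b c where x: "x = a *\<^sub>R e1 + b *\<^sub>R e2 + c *\<^sub>R e3"
    unfolding span_insert span_empty by (auto simp: algebra_simps)
  have "e2 \<bullet> e1 = 0" "e3 \<bullet> e1 = 0" "e3 \<bullet> e2 = 0" using assms(4-6) by (simp_all add: inner_commute)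
  then have "x \<bullet> e1 = a" "x \<bullet> e2 = b" "x \<bullet> e3 = c"
    unfolding x using n assms(4-6) by (simp_all add: inner_add_left)
  then show ?thesis using x by simp
qed

lemma trace_orthonormal:
  fixes T :: "real ^ 3 \<Rightarrow> real ^ 3"
  assumes T: "linear T"
    and e: "norm e1 = 1" "norm e2 = 1" "norm e3 = 1" "e1 \<bullet> e2 = 0" "e1 \<bullet> e3 = 0" "e2 \<bullet> e3 = 0"
  shows "(\<Sum>b\<in>Basis. T b \<bullet> b) = T e1 \<bullet> e1 + T e2 \<bullet> e2 + T e3 \<bullet> e3"
proof -
  have k: "(\<Sum>b\<in>Basis. (T b \<bullet> u) * (b \<bullet> u)) = T u \<bullet> u" for u
  proof -
    have "T u = (\<Sum>b\<in>Basis. (u \<bullet> b) *\<^sub>R T b)" by (rule linear_expand_Basis[OF T])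
    then have "T u \<bullet> u = (\<Sum>b\<in>Basis. (u \<bullet> b) * (T b \<bullet> u))" by (simp add: inner_sum_left)
    then show ?thesis by (simp add: inner_commute mult.commute)
  qed
  have "T b \<bullet> b = (T b \<bullet> e1) * (b \<bullet> e1) + (T b \<bullet> e2) * (b \<bullet> e2) + (T b \<bullet> e3) * (b \<bullet> e3)" for b
  proof -
    have "T b \<bullet> b = T b \<bullet> ((b \<bullet> e1) *\<^sub>R e1 + (b \<bullet> e2) *\<^sub>R e2 + (b \<bullet> e3) *\<^sub>R e3)"
      using orthonormal_expand[OF e, of b] by simp
    then show ?thesis by (simp add: inner_add_right mult.commute)
  qed
  then have "(\<Sum>b\<in>Basis. T b \<bullet> b) = (\<Sum>b\<in>Basis. (T b \<bullet> e1) * (b \<bullet> e1) +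
      (T b \<bullet> e2) * (b \<bullet> e2) + (T b \<bullet> e3) * (b \<bullet> e3))"
    by (rule sum.cong[OF refl])
  then show ?thesis by (simp only: sum.distrib k)
qed

lemma trace_commute:
  fixes S T :: "'e::euclidean_space \<Rightarrow> 'e"
  assumes S: "linear S" and T: "linear T"
  shows "(\<Sum>b\<in>Basis. S (T b) \<bullet> b) = (\<Sum>b\<in>Basis. T (S b) \<bullet> b)"
proof -
  have e: "(\<Sum>b\<in>Basis. F (H b) \<bullet> b) = (\<Sum>b\<in>Basis. \<Sum>c\<in>Basis. (H b \<bullet> c) * (F c \<bullet> b))"
    if "linear F" for F H :: "'e \<Rightarrow> 'e"
  proof (rule sum.cong[OF refl])
    fix b
    have "F (H b) = (\<Sum>c\<in>Basis. (H b \<bullet> c) *\<^sub>R F c)" by (rule linear_expand_Basis[OF that])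
    then show "F (H b) \<bullet> b = (\<Sum>c\<in>Basis. (H b \<bullet> c) * (F c \<bullet> b))" by (simp add: inner_sum_left)
  qed
  show ?thesis
    unfolding e[OF S] e[OF T] by (subst sum.swap) (simp add: mult.commute)
qed

text \<open>
  If \<open>r\<close> is the sum of the off-diagonal entries of a bilinear form on the plane and \<open>m\<close> the second
  minus the first diagonal entry, then the second equation says that the off-diagonal entries sum to
  \<open>0\<close> after a rotation with cosine \<open>c\<close> and sine \<open>s\<close>. The angle is \<open>t / 2\<close> with
  \<open>r cos t + m sin t = 0\<close>.
\<close>

lemma diagonalising_rotation:
  fixes r m :: real
  obtains c s where "c\<^sup>2 + s\<^sup>2 = 1" "(c\<^sup>2 - s\<^sup>2) * r + 2 * c * s * m = 0"
proof -
  obtain t where t: "cos t * r + sin t * m = 0"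
  proof (cases "m = 0")
    case True
    then show thesis using that[of "pi / 2"] by simp
  next
    case False
    have "cos (arctan (- r / m)) * tan (arctan (- r / m)) = sin (arctan (- r / m))"
      by (simp add: tan_def cos_arctan_not_zero)
    then have "sin (arctan (- r / m)) = cos (arctan (- r / m)) * (- r / m)" by (simp add: tan_arctan)
    then show thesis using that[of "arctan (- r / m)"] False by simp
  qed
  have "cos t = (cos (t / 2))\<^sup>2 - (sin (t / 2))\<^sup>2" "sin t = 2 * cos (t / 2) * sin (t / 2)"
    using cos_double[of "t / 2"] sin_double[of "t / 2"] by simp_all
  then show thesis using that[of "cos (t / 2)" "sin (t / 2)"] t by simp
qed

text \<open>
  What a conjugate symmetric left invariant statistical structure leaves on the Lie algebra, after an
  isometry with Euclidean space. The bracket is the antisymmetrisation of the connection \<open>d\<close>, and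
  \<open>C\<close> is its non-metricity.
\<close>

locale conjugate_symmetric_algebra =
  fixes d :: "real ^ 3 \<Rightarrow> real ^ 3 \<Rightarrow> real ^ 3"
    and br C curv
  assumes br_def: "br x y = d x y - d y x"
    and C_def: "C x y z = - (d x y \<bullet> z) - y \<bullet> d x z"
    and curv_def: "curv x y z = d x (d y z) - d y (d x z) - d (br x y) z"
    and bilinear_d: "bilinear d"
    and C_sym: "C x y z = C y x z"
    and jacobi: "br x (br y z) + br y (br z x) + br z (br x y) = 0"
    and curv_skew: "curv x y z \<bullet> w = - (curv x y w \<bullet> z)"
begin

lemmas d_simps = bilinear_ladd[OF bilinear_d] bilinear_radd[OF bilinear_d] bilinear_lmul[OF bilinear_d]
  bilinear_rmul[OF bilinear_d] bilinear_lneg[OF bilinear_d] bilinear_rneg[OF bilinear_d]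
  bilinear_lsub[OF bilinear_d] bilinear_rsub[OF bilinear_d]
  bilinear_lzero[OF bilinear_d] bilinear_rzero[OF bilinear_d]

lemma br_alt: "br x x = 0" "br y x = - br x y"
  by (simp_all add: br_def)

lemma linear_br: "linear (br x)"
  by (rule linearI) (simp_all add: br_def d_simps algebra_simps)

lemma bilinear_br: "bilinear br"
  unfolding bilinear_def
  by (intro conjI allI linearI) (simp_all add: br_def d_simps algebra_simps)

lemmas br_simps = bilinear_ladd[OF bilinear_br] bilinear_radd[OF bilinear_br] bilinear_lmul[OF bilinear_br]
  bilinear_rmul[OF bilinear_br] bilinear_lneg[OF bilinear_br] bilinear_rneg[OF bilinear_br]
  bilinear_lsub[OF bilinear_br] bilinear_rsub[OF bilinear_br]

lemma C_sym': "C x y z = C x z y"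
  by (simp add: C_def inner_commute)

definition tr :: "real ^ 3 \<Rightarrow> real" where "tr x = (\<Sum>b\<in>Basis. br x b \<bullet> b)"

lemma linear_tr: "linear tr"
  by (rule linearI) (simp_all add: tr_def br_simps inner_add_left sum.distrib sum_distrib_left)

text \<open>By the Jacobi identity, \<open>ad [x, y]\<close> is the commutator of \<open>ad x\<close> and \<open>ad y\<close>.\<close>

lemma tr_br: "tr (br x y) = 0"
proof -
  have "br (br x y) b = br x (br y b) - br y (br x b)" for b
    using jacobi[of x y b] br_alt(2)[of b x] br_alt(2)[of b "br x y"] by (simp add: br_simps algebra_simps)
  then show ?thesis
    using trace_commute[OF linear_br[of x] linear_br[of y]]
    by (simp add: tr_def inner_diff_left sum_subtractf)
qed

text \<open>
  Let \<open>e1\<close> be the unit normal of the kernel of \<open>tr\<close>. All brackets lie in this kernel, so the traces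
  of \<open>ad e2\<close> and \<open>ad e3\<close> reduce to the two components of \<open>[e2, e3]\<close>; as they vanish, the kernel is
  an abelian ideal. A rotation in the kernel diagonalises the symmetric part of \<open>ad e1\<close>, which makes
  the off-diagonal entries \<open>a\<close> and \<open>- a\<close>.
\<close>

lemma adapted_basis:
  assumes "tr x \<noteq> 0"
  obtains e1 e2 e3 p q a where
    "norm e1 = 1" "norm e2 = 1" "norm e3 = 1" "e1 \<bullet> e2 = 0" "e1 \<bullet> e3 = 0" "e2 \<bullet> e3 = 0"
    "br e1 e2 = p *\<^sub>R e2 + a *\<^sub>R e3" "br e1 e3 = (- a) *\<^sub>R e2 + q *\<^sub>R e3" "br e2 e3 = 0" "p + q \<noteq> 0"
proof -
  define u where "u = (\<Sum>b\<in>Basis. tr b *\<^sub>R b)"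
  have u: "tr y = y \<bullet> u" for y
    using linear_expand_Basis[OF linear_tr, of y] by (simp add: u_def inner_sum_right mult.commute)
  have u0: "u \<noteq> 0" using u[of x] assms by auto
  define e1 where "e1 = (1 / norm u) *\<^sub>R u"
  have e1: "norm e1 = 1" using u0 by (simp add: e1_def)
  have tre: "tr y = norm u * (y \<bullet> e1)" for y using u0 by (simp add: u e1_def)
  obtain f where f: "orthogonal_transformation f" "f (axis 1 1 :: real ^ 3) = e1"
    using orthogonal_transformation_exists[of "axis 1 1 :: real ^ 3" e1] e1 by (auto simp: norm_axis_1)
  define f2 f3 where "f2 = f (axis 2 1)" and "f3 = f (axis 3 1)"
  have fn: "norm f2 = 1" "norm f3 = 1"
    unfolding f2_def f3_def using f(1) by (simp_all add: orthogonal_transformation_norm norm_axis_1)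
  have fi: "f v \<bullet> f w = v \<bullet> w" for v w using f(1) unfolding orthogonal_transformation_def by blast
  have fo: "e1 \<bullet> f2 = 0" "e1 \<bullet> f3 = 0" "f2 \<bullet> f3 = 0"
    unfolding f2_def f3_def f(2)[symmetric] fi by (simp_all add: inner_axis_axis)
  define r where "r = br e1 f2 \<bullet> f3 + br e1 f3 \<bullet> f2"
  define m where "m = br e1 f3 \<bullet> f3 - br e1 f2 \<bullet> f2"
  obtain c s where cs: "c\<^sup>2 + s\<^sup>2 = 1" "(c\<^sup>2 - s\<^sup>2) * r + 2 * c * s * m = 0"
    by (rule diagonalising_rotation)
  define e2 e3 where "e2 = c *\<^sub>R f2 + s *\<^sub>R f3" and "e3 = (- s) *\<^sub>R f2 + c *\<^sub>R f3"
  have ff: "f2 \<bullet> f2 = 1" "f3 \<bullet> f3 = 1" using fn by (simp_all add: norm_eq_1)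
  have e: "norm e2 = 1" "norm e3 = 1" "e1 \<bullet> e2 = 0" "e1 \<bullet> e3 = 0" "e2 \<bullet> e3 = 0"
    using cs(1) fo ff
    by (simp_all add: e2_def e3_def norm_eq_1 inner_add_left inner_add_right inner_commute[of f3 f2]
        power2_eq_square algebra_simps)
  note on = e1 e
  have n: "e2 \<bullet> e1 = 0" "e3 \<bullet> e1 = 0" using e(3,4) by (simp_all add: inner_commute)
  have br1: "br v w \<bullet> e1 = 0" for v w
    using tr_br[of v w] tre[of "br v w"] u0 by simp
  have tr3: "tr y = br y e1 \<bullet> e1 + br y e2 \<bullet> e2 + br y e3 \<bullet> e3" for y
    unfolding tr_def by (rule trace_orthonormal[OF linear_br on])
  have b233: "br e2 e3 \<bullet> e3 = 0" using tr3[of e2] tre[of e2] n br1 br_alt(1) by simp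
  have b232: "br e2 e3 \<bullet> e2 = 0" using tr3[of e3] tre[of e3] n br1 br_alt(1) br_alt(2)[of e2 e3] by simp
  have b23: "br e2 e3 = 0"
    by (rule trans[OF orthonormal_expand[OF on]]) (simp add: br1 b232 b233)
  have "br e1 e2 \<bullet> e3 + br e1 e3 \<bullet> e2 = (c\<^sup>2 - s\<^sup>2) * r + 2 * c * s * m"
    unfolding e2_def e3_def r_def m_def
    by (simp add: br_simps inner_add_left inner_add_right power2_eq_square algebra_simps)
  then have a: "br e1 e3 \<bullet> e2 = - (br e1 e2 \<bullet> e3)" using cs(2) by simp
  have b12: "br e1 e2 = (br e1 e2 \<bullet> e2) *\<^sub>R e2 + (br e1 e2 \<bullet> e3) *\<^sub>R e3"
    by (rule trans[OF orthonormal_expand[OF on]]) (simp add: br1)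
  have b13: "br e1 e3 = (- (br e1 e2 \<bullet> e3)) *\<^sub>R e2 + (br e1 e3 \<bullet> e3) *\<^sub>R e3"
    by (rule trans[OF orthonormal_expand[OF on]]) (simp add: br1 a)
  have "br e1 e2 \<bullet> e2 + br e1 e3 \<bullet> e3 \<noteq> 0"
    using tr3[of e1] tre[of e1] u0 br1 e1 by (metis add_0 mult.right_neutral norm_eq_1 norm_eq_zero)
  from that[OF on b12 b13 b23 this] show thesis .
qed

text \<open>
  Symmetry of \<open>C\<close> allows each argument in turn to be moved to the first place and expanded there.
\<close>

lemma C_zero:
  assumes e: "norm e1 = 1" "norm e2 = 1" "norm e3 = 1" "e1 \<bullet> e2 = 0" "e1 \<bullet> e3 = 0" "e2 \<bullet> e3 = 0"
    and z: "\<And>i j k. i \<in> {e1, e2, e3} \<Longrightarrow> j \<in> {e1, e2, e3} \<Longrightarrow> k \<in> {e1, e2, e3} \<Longrightarrow> C i j k = 0"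
  shows "C x y w = 0"
proof -
  have ext: "C x v w = 0" if "\<And>i. i \<in> {e1, e2, e3} \<Longrightarrow> C i v w = 0" for x v w
  proof -
    have "C x v w = C ((x \<bullet> e1) *\<^sub>R e1 + (x \<bullet> e2) *\<^sub>R e2 + (x \<bullet> e3) *\<^sub>R e3) v w"
      using orthonormal_expand[OF e, of x] by simp
    also have "\<dots> = (x \<bullet> e1) * C e1 v w + (x \<bullet> e2) * C e2 v w + (x \<bullet> e3) * C e3 v w"
      by (simp add: C_def d_simps inner_add_left inner_add_right algebra_simps)
    finally show ?thesis using that by simp
  qed
  have 1: "C i j w = 0" if "i \<in> {e1, e2, e3}" "j \<in> {e1, e2, e3}" for i j w
    using ext[of i j w] z that C_sym C_sym' by metis
  have 2: "C i y w = 0" if "i \<in> {e1, e2, e3}" for i y w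
    using ext[of i w y] 1 that C_sym C_sym' by metis
  show ?thesis by (rule ext) (rule 2)
qed

lemma curv_inner:
  assumes e: "norm e1 = 1" "norm e2 = 1" "norm e3 = 1" "e1 \<bullet> e2 = 0" "e1 \<bullet> e3 = 0" "e2 \<bullet> e3 = 0"
  shows "curv x y z \<bullet> w =
    (d y z \<bullet> e1) * (d x e1 \<bullet> w) + (d y z \<bullet> e2) * (d x e2 \<bullet> w) + (d y z \<bullet> e3) * (d x e3 \<bullet> w)
    - ((d x z \<bullet> e1) * (d y e1 \<bullet> w) + (d x z \<bullet> e2) * (d y e2 \<bullet> w) + (d x z \<bullet> e3) * (d y e3 \<bullet> w))
    - ((br x y \<bullet> e1) * (d e1 z \<bullet> w) + (br x y \<bullet> e2) * (d e2 z \<bullet> w) + (br x y \<bullet> e3) * (d e3 z \<bullet> w))"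
proof -
  have 1: "d v h \<bullet> w = (h \<bullet> e1) * (d v e1 \<bullet> w) + (h \<bullet> e2) * (d v e2 \<bullet> w) + (h \<bullet> e3) * (d v e3 \<bullet> w)" for v h
  proof -
    have "d v h \<bullet> w = d v ((h \<bullet> e1) *\<^sub>R e1 + (h \<bullet> e2) *\<^sub>R e2 + (h \<bullet> e3) *\<^sub>R e3) \<bullet> w"
      using orthonormal_expand[OF e, of h] by simp
    then show ?thesis by (simp add: d_simps inner_add_left)
  qed
  have 2: "d h v \<bullet> w = (h \<bullet> e1) * (d e1 v \<bullet> w) + (h \<bullet> e2) * (d e2 v \<bullet> w) + (h \<bullet> e3) * (d e3 v \<bullet> w)" for v h
  proof -
    have "d h v \<bullet> w = d ((h \<bullet> e1) *\<^sub>R e1 + (h \<bullet> e2) *\<^sub>R e2 + (h \<bullet> e3) *\<^sub>R e3) v \<bullet> w"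
      using orthonormal_expand[OF e, of h] by simp
    then show ?thesis by (simp add: d_simps inner_add_left)
  qed
  show ?thesis
    unfolding curv_def inner_diff_left 1[of x "d y z"] 1[of y "d x z"] 2[of "br x y"] ..
qed

text \<open>The Koszul formula, with the cubic form as the non-metricity of \<open>d\<close>.\<close>

lemma koszul: "d x y \<bullet> z = (br x y \<bullet> z - br y z \<bullet> x + br z x \<bullet> y - C x y z) / 2"
proof -
  have c: "d u v \<bullet> w + d u w \<bullet> v = - C u v w" for u v w
    by (simp add: C_def inner_commute[of v "d u w"])
  have "C y x z = C x y z" "C z y x = C x y z" "C x z y = C x y z"
    using C_sym C_sym' by metis+
  then show ?thesis
    using c[of x y z] c[of y x z] c[of z y x] by (simp add: br_def inner_diff_left)
qed

text \<open>
  The Koszul formula writes \<open>d\<close> in terms of \<open>p\<close>, \<open>q\<close>, \<open>a\<close> and the components of \<open>C\<close>. In the sum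
  \<open>curv x y z \<bullet> w + curv x y w \<bullet> z\<close>, which is symmetric in \<open>z\<close> and \<open>w\<close>, the terms free of \<open>C\<close> and the
  terms quadratic in \<open>C\<close> cancel, and what remains is the linear Codazzi system.
\<close>

lemma adapted_basis_constants:
  assumes e: "norm e1 = 1" "norm e2 = 1" "norm e3 = 1" "e1 \<bullet> e2 = 0" "e1 \<bullet> e3 = 0" "e2 \<bullet> e3 = 0"
    and b: "br e1 e2 = p *\<^sub>R e2 + a *\<^sub>R e3" "br e1 e3 = (- a) *\<^sub>R e2 + q *\<^sub>R e3" "br e2 e3 = 0"
    and pq: "p + q \<noteq> 0" and nz: "C x y z \<noteq> 0"
  shows "p = q \<or> a = 0 \<and> (p = 0 \<or> q = 0)"
proof -
  have n: "e1 \<bullet> e1 = 1" "e2 \<bullet> e2 = 1" "e3 \<bullet> e3 = 1" "e2 \<bullet> e1 = 0" "e3 \<bullet> e1 = 0" "e3 \<bullet> e2 = 0"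
    using e by (simp_all add: norm_eq_1 inner_commute)
  define c111 where "c111 = C e1 e1 e1"
  define c112 where "c112 = C e1 e1 e2"
  define c113 where "c113 = C e1 e1 e3"
  define c122 where "c122 = C e1 e2 e2"
  define c123 where "c123 = C e1 e2 e3"
  define c133 where "c133 = C e1 e3 e3"
  define c222 where "c222 = C e2 e2 e2"
  define c223 where "c223 = C e2 e2 e3"
  define c233 where "c233 = C e2 e3 e3"
  define c333 where "c333 = C e3 e3 e3"
  note c_defs = c111_def c112_def c113_def c122_def c123_def c133_def c222_def c223_def c233_def c333_def
  have cs: "C e1 e1 e1 = c111"
    "C e1 e1 e2 = c112"
    "C e1 e1 e3 = c113"
    "C e1 e2 e1 = c112"
    "C e1 e2 e2 = c122"
    "C e1 e2 e3 = c123"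
    "C e1 e3 e1 = c113"
    "C e1 e3 e2 = c123"
    "C e1 e3 e3 = c133"
    "C e2 e1 e1 = c112"
    "C e2 e1 e2 = c122"
    "C e2 e1 e3 = c123"
    "C e2 e2 e1 = c122"
    "C e2 e2 e2 = c222"
    "C e2 e2 e3 = c223"
    "C e2 e3 e1 = c123"
    "C e2 e3 e2 = c223"
    "C e2 e3 e3 = c233"
    "C e3 e1 e1 = c113"
    "C e3 e1 e2 = c123"
    "C e3 e1 e3 = c133"
    "C e3 e2 e1 = c123"
    "C e3 e2 e2 = c223"
    "C e3 e2 e3 = c233"
    "C e3 e3 e1 = c133"
    "C e3 e3 e2 = c233"
    "C e3 e3 e3 = c333"
    unfolding c_defs using C_sym C_sym' by metis+
  have B: "br e1 e1 = 0" "br e2 e2 = 0" "br e3 e3 = 0" "br e1 e2 = p *\<^sub>R e2 + a *\<^sub>R e3"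
    "br e1 e3 = (- a) *\<^sub>R e2 + q *\<^sub>R e3" "br e2 e3 = 0" "br e2 e1 = - (p *\<^sub>R e2 + a *\<^sub>R e3)"
    "br e3 e1 = - ((- a) *\<^sub>R e2 + q *\<^sub>R e3)" "br e3 e2 = 0"
    using b br_alt(1) br_alt(2)[of e2 e1] br_alt(2)[of e3 e1] br_alt(2)[of e3 e2] by simp_all
  have D: "d e1 e1 \<bullet> e1 = 0 - c111 / 2"
    "d e1 e1 \<bullet> e2 = 0 - c112 / 2"
    "d e1 e1 \<bullet> e3 = 0 - c113 / 2"
    "d e1 e2 \<bullet> e1 = 0 - c112 / 2"
    "d e1 e2 \<bullet> e2 = 0 - c122 / 2"
    "d e1 e2 \<bullet> e3 = a - c123 / 2"
    "d e1 e3 \<bullet> e1 = 0 - c113 / 2"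
    "d e1 e3 \<bullet> e2 = - a - c123 / 2"
    "d e1 e3 \<bullet> e3 = 0 - c133 / 2"
    "d e2 e1 \<bullet> e1 = 0 - c112 / 2"
    "d e2 e1 \<bullet> e2 = - p - c122 / 2"
    "d e2 e1 \<bullet> e3 = 0 - c123 / 2"
    "d e2 e2 \<bullet> e1 = p - c122 / 2"
    "d e2 e2 \<bullet> e2 = 0 - c222 / 2"
    "d e2 e2 \<bullet> e3 = 0 - c223 / 2"
    "d e2 e3 \<bullet> e1 = 0 - c123 / 2"
    "d e2 e3 \<bullet> e2 = 0 - c223 / 2"
    "d e2 e3 \<bullet> e3 = 0 - c233 / 2"
    "d e3 e1 \<bullet> e1 = 0 - c113 / 2"
    "d e3 e1 \<bullet> e2 = 0 - c123 / 2"
    "d e3 e1 \<bullet> e3 = - q - c133 / 2"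
    "d e3 e2 \<bullet> e1 = 0 - c123 / 2"
    "d e3 e2 \<bullet> e2 = 0 - c223 / 2"
    "d e3 e2 \<bullet> e3 = 0 - c233 / 2"
    "d e3 e3 \<bullet> e1 = q - c133 / 2"
    "d e3 e3 \<bullet> e2 = 0 - c233 / 2"
    "d e3 e3 \<bullet> e3 = 0 - c333 / 2"
    by (simp_all add: koszul B cs n e(4-6) inner_add_left inner_diff_left diff_divide_distrib)
  have Bc: "br e1 e2 \<bullet> e1 = 0"
    "br e1 e2 \<bullet> e2 = p"
    "br e1 e2 \<bullet> e3 = a"
    "br e1 e3 \<bullet> e1 = 0"
    "br e1 e3 \<bullet> e2 = - a"
    "br e1 e3 \<bullet> e3 = q"
    "br e2 e3 \<bullet> e1 = 0"
    "br e2 e3 \<bullet> e2 = 0"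
    "br e2 e3 \<bullet> e3 = 0"
    by (simp_all add: B n e(4-6) inner_add_left inner_diff_left)
  note ci = curv_inner[OF e]
  have sk: "curv x y z \<bullet> w + curv x y w \<bullet> z = 0" for x y z w
    using curv_skew[of x y z w] by simp
  have E1: "(q - p) * c123 = 0"
    using sk[of e2 e3 e1 e1] unfolding ci D Bc by algebra
  have E2: "(q - p) * c223 = - (p * c113)"
    using sk[of e2 e3 e1 e2] unfolding ci D Bc by algebra
  have E3: "(q - p) * c233 = q * c112"
    using sk[of e2 e3 e1 e3] unfolding ci D Bc by algebra
  have E4: "q * c122 = p * c133"
    using sk[of e2 e3 e2 e3] unfolding ci D Bc by algebra
  have E5: "3 * p * c112 = - (a * c113)"
    using sk[of e1 e2 e1 e1] unfolding ci D Bc by algebra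
  have E6: "p * (2 * c122 - c111) = - (2 * a * c123)"
    using sk[of e1 e2 e1 e2] unfolding ci D Bc by algebra
  have E7: "a * (c122 - c133) = 2 * p * c123"
    using sk[of e1 e2 e1 e3] unfolding ci D Bc by algebra
  have E8: "p * (c222 - 2 * c112) = - (3 * a * c223)"
    using sk[of e1 e2 e2 e2] unfolding ci D Bc by algebra
  have E9: "p * c233 = a * (2 * c223 - c333)"
    using sk[of e1 e2 e3 e3] unfolding ci D Bc by algebra
  have E10: "p * (c223 - c113) = a * (c222 - 2 * c233)"
    using sk[of e1 e2 e2 e3] unfolding ci D Bc by algebra
  have E11: "3 * q * c113 = a * c112"
    using sk[of e1 e3 e1 e1] unfolding ci D Bc by algebra
  have E12: "q * (2 * c133 - c111) = 2 * a * c123"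
    using sk[of e1 e3 e1 e3] unfolding ci D Bc by algebra
  have E13: "q * (c333 - 2 * c113) = 3 * a * c233"
    using sk[of e1 e3 e3 e3] unfolding ci D Bc by algebra
  have E14: "q * c223 = - (a * (2 * c233 - c222))"
    using sk[of e1 e3 e2 e2] unfolding ci D Bc by algebra
  have E15: "q * (c233 - c112) = - (a * (c333 - 2 * c223))"
    using sk[of e1 e3 e2 e3] unfolding ci D Bc by algebra
  have "c111 \<noteq> 0 \<or> c112 \<noteq> 0 \<or> c113 \<noteq> 0 \<or> c122 \<noteq> 0 \<or> c123 \<noteq> 0 \<or> c133 \<noteq> 0 \<or>
      c222 \<noteq> 0 \<or> c223 \<noteq> 0 \<or> c233 \<noteq> 0 \<or> c333 \<noteq> 0"
  proof (rule ccontr)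
    assume "\<not> ?thesis"
    then have z: "c111 = 0" "c112 = 0" "c113 = 0" "c122 = 0" "c123 = 0" "c133 = 0"
      "c222 = 0" "c223 = 0" "c233 = 0" "c333 = 0" by simp_all
    have "C x y z = 0" by (rule C_zero[OF e]) (auto simp: cs z)
    then show False using nz by simp
  qed
  from codazzi_solution[OF pq E1 E2 E3 E4 E5 E6 E7 E8 E9 E10 E11 E12 E13 E14 E15 this] show ?thesis .
qed

lemma model_isomorphism:
  assumes o: "f1 \<bullet> f2 = 0" "f1 \<bullet> f3 = 0" "f2 \<bullet> f3 = 0" and nz: "f1 \<noteq> 0" "f2 \<noteq> 0" "f3 \<noteq> 0"
    and b: "br f1 f2 = (1 + \<xi>) *\<^sub>R (f2 + \<eta> *\<^sub>R f3)" "br f3 f1 = (1 - \<xi>) *\<^sub>R (\<eta> *\<^sub>R f2 - f3)" "br f2 f3 = 0"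
  shows "\<exists>T :: real ^ 3 \<Rightarrow> real ^ 3. linear T \<and> bij T \<and> (\<forall>x y. T (model_bracket \<xi> \<eta> x y) = br (T x) (T y))"
proof -
  define T where "T x = (x $ 1) *\<^sub>R f1 + (x $ 2) *\<^sub>R f2 + (x $ 3) *\<^sub>R f3" for x :: "real ^ 3"
  have lin: "linear T"
    by (rule linearI) (simp_all add: T_def algebra_simps)
  have o': "f2 \<bullet> f1 = 0" "f3 \<bullet> f1 = 0" "f3 \<bullet> f2 = 0" using o by (simp_all add: inner_commute)
  have "inj T"
  proof (rule linear_injective_0[OF lin, THEN iffD2], intro allI impI)
    fix x assume "T x = 0"
    then have "T x \<bullet> f1 = 0" "T x \<bullet> f2 = 0" "T x \<bullet> f3 = 0" by simp_all
    then have "x $ 1 = 0" "x $ 2 = 0" "x $ 3 = 0"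
      using nz o o' by (simp_all add: T_def inner_add_left)
    then show "x = 0" by (simp add: vec_eq_iff forall_3)
  qed
  then have "bij T" using linear_injective_imp_surjective[OF lin] by (simp add: bij_def)
  moreover have "T (model_bracket \<xi> \<eta> x y) = br (T x) (T y)" for x y
  proof -
    have b': "br f1 f1 = 0" "br f2 f2 = 0" "br f3 f3 = 0" "br f2 f1 = - br f1 f2"
      "br f1 f3 = - br f3 f1" "br f3 f2 = - br f2 f3"
      by (simp_all add: br_def)
    have "br (T x) (T y) = (x $ 1 * y $ 2 - x $ 2 * y $ 1) *\<^sub>R br f1 f2 +
        (x $ 3 * y $ 1 - x $ 1 * y $ 3) *\<^sub>R br f3 f1 + (x $ 2 * y $ 3 - x $ 3 * y $ 2) *\<^sub>R br f2 f3"
      unfolding T_def by (simp add: br_simps b' algebra_simps)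
    then show ?thesis
      unfolding b by (simp add: T_def model_bracket_def axis_def algebra_simps)
  qed
  ultimately show ?thesis using lin by blast
qed

text \<open>
  If \<open>p = q\<close>, dividing \<open>e1\<close> by \<open>p\<close> gives the model with parameters \<open>0\<close> and \<open>a / p\<close>, and replacing \<open>e3\<close> by
  \<open>- e3\<close> changes the sign of the second parameter. Otherwise \<open>ad e1\<close> is diagonal of rank one on the
  plane of \<open>e2, e3\<close>; then \<open>e1\<close> is scaled so that the nonzero eigenvalue becomes \<open>2\<close>, and \<open>e2, e3\<close>
  are exchanged if it belongs to \<open>e3\<close>.
\<close>

lemma model_classification:
  assumes "tr x \<noteq> 0" and "C u v w \<noteq> 0"
  shows "\<exists>\<xi> \<eta>. (\<xi> = 0 \<and> \<eta> \<ge> 0 \<or> \<xi> = 1 \<and> \<eta> = 0) \<and>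
    (\<exists>T :: real ^ 3 \<Rightarrow> real ^ 3. linear T \<and> bij T \<and> (\<forall>x y. T (model_bracket \<xi> \<eta> x y) = br (T x) (T y)))"
proof -
  obtain e1 e2 e3 p q a where
    e: "norm e1 = 1" "norm e2 = 1" "norm e3 = 1" "e1 \<bullet> e2 = 0" "e1 \<bullet> e3 = 0" "e2 \<bullet> e3 = 0"
    and b: "br e1 e2 = p *\<^sub>R e2 + a *\<^sub>R e3" "br e1 e3 = (- a) *\<^sub>R e2 + q *\<^sub>R e3" "br e2 e3 = 0"
    and pq: "p + q \<noteq> 0"
    by (rule adapted_basis[OF assms(1)])
  have n: "e1 \<noteq> 0" "e2 \<noteq> 0" "e3 \<noteq> 0" using e(1-3) by auto
  have b': "br e3 e1 = a *\<^sub>R e2 - q *\<^sub>R e3" "br e2 e1 = - (p *\<^sub>R e2 + a *\<^sub>R e3)" "br e3 e2 = 0"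
    using br_alt(2)[of e3 e1] br_alt(2)[of e2 e1] br_alt(2)[of e3 e2] b by simp_all
  consider "p = q" "p \<noteq> 0" | "a = 0" "p = 0" "q \<noteq> 0" | "a = 0" "q = 0" "p \<noteq> 0"
    using adapted_basis_constants[OF e b pq assms(2)] pq by auto
  then show ?thesis
  proof cases
    case 1
    define s where "s = (if a / p \<ge> 0 then 1 else - 1 :: real)"
    have s: "s \<noteq> 0" "s * s = 1" "s * (a / p) \<ge> 0" by (auto simp: s_def)
    have "\<exists>T :: real ^ 3 \<Rightarrow> real ^ 3. linear T \<and> bij T \<and>
        (\<forall>x y. T (model_bracket 0 (s * (a / p)) x y) = br (T x) (T y))"
    proof (rule model_isomorphism)
      show "br ((1 / p) *\<^sub>R e1) e2 = (1 + 0) *\<^sub>R (e2 + (s * (a / p)) *\<^sub>R (s *\<^sub>R e3))"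
        using 1 s(2) b(1) by (simp add: br_simps scaleR_add_right mult.commute mult.left_commute)
      show "br (s *\<^sub>R e3) ((1 / p) *\<^sub>R e1) = (1 - 0) *\<^sub>R ((s * (a / p)) *\<^sub>R e2 - s *\<^sub>R e3)"
        using 1 b'(1) by (simp add: br_simps scaleR_diff_right)
      show "br e2 (s *\<^sub>R e3) = 0" using b(3) by (simp add: br_simps)
    qed (use e n 1 s in auto)
    then show ?thesis using s(3) by blast
  next
    case 2
    have "\<exists>T :: real ^ 3 \<Rightarrow> real ^ 3. linear T \<and> bij T \<and>
        (\<forall>x y. T (model_bracket 1 0 x y) = br (T x) (T y))"
    proof (rule model_isomorphism)
      show "br ((2 / q) *\<^sub>R e1) e3 = (1 + 1) *\<^sub>R (e3 + 0 *\<^sub>R e2)"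
        using 2 b(2) by (simp add: br_simps)
      show "br e2 ((2 / q) *\<^sub>R e1) = (1 - 1) *\<^sub>R (0 *\<^sub>R e3 - e2)"
        using 2 b'(2) by (simp add: br_simps)
    qed (use e n 2 b'(3) in \<open>auto simp: inner_commute\<close>)
    then show ?thesis by blast
  next
    case 3
    have "\<exists>T :: real ^ 3 \<Rightarrow> real ^ 3. linear T \<and> bij T \<and>
        (\<forall>x y. T (model_bracket 1 0 x y) = br (T x) (T y))"
    proof (rule model_isomorphism)
      show "br ((2 / p) *\<^sub>R e1) e2 = (1 + 1) *\<^sub>R (e2 + 0 *\<^sub>R e3)"
        using 3 b(1) by (simp add: br_simps)
      show "br e3 ((2 / p) *\<^sub>R e1) = (1 - 1) *\<^sub>R (0 *\<^sub>R e2 - e3)"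
        using 3 b'(1) by (simp add: br_simps)
    qed (use e n 3 b(3) in auto)
    then show ?thesis by blast
  qed
qed

end

section \<open>The classification\<close>

theorem theorem8p4:
  fixes A :: "('g::{group_add,t2_space,second_countable_topology}, real ^ 3) chart set"
    and g :: "'g metric" and D :: "'g connection"
  assumes "lie_group A"
    and "\<not> unimodular A"
    and "left_invariant_statistical_structure A g D"
    and "D \<noteq> levi_civita A g"
    and "conjugate_symmetric A g D"
  shows "(\<exists>\<eta>\<ge>0. locally_isomorphic_to_model A 0 \<eta>) \<or> locally_isomorphic_to_model A 1 0"
proof -
  interpret smooth_group A
    using assms(1) unfolding lie_group_def by unfold_locales auto
  have g: "riemannian_metric A g" "left_invariant_metric A g"
    using assms(3) unfolding left_invariant_statistical_structure_def statistical_structure_def by auto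
  obtain \<Phi> :: "real ^ 3 \<Rightarrow> 'g vfield" where \<Phi>: "linear \<Phi>" "bij_betw \<Phi> UNIV (lie_algebra A)"
    "\<And>x y. metric_apply g (\<Phi> x) (\<Phi> y) = (\<lambda>p. x \<bullet> y)"
    "\<And>p. bij_betw (\<lambda>x. \<Phi> x p) UNIV (tangent_space A p)"
    using orthonormal_left_frame[OF g] by blast
  interpret statistical_frame A g D \<Phi>
    by (rule statistical_frame.intro[OF smooth_group_axioms])
      (rule statistical_frame_axioms.intro[OF assms(3) \<Phi>])
  interpret alg: conjugate_symmetric_algebra conn br cubic curv
    by (rule conjugate_symmetric_algebra.intro)
      (rule br_def cubic_def curv_def bilinear_conn cubic_sym br_jacobi curv_skew[OF assms(5)])+
  obtain x where x: "alg.tr x \<noteq> 0"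
    using trace_nonzero[OF assms(2)] unfolding alg.tr_def by blast
  obtain u v w where uvw: "cubic u v w \<noteq> 0"
    using cubic_nonzero[OF assms(4)] by blast
  obtain \<xi> \<eta> and T :: "real ^ 3 \<Rightarrow> real ^ 3" where
    \<xi>: "\<xi> = 0 \<and> \<eta> \<ge> 0 \<or> \<xi> = 1 \<and> \<eta> = 0" and T: "linear T" "bij T"
    "\<forall>x y. T (model_bracket \<xi> \<eta> x y) = br (T x) (T y)"
    using alg.model_classification[OF x uvw] by blast
  have "locally_isomorphic_to_model A \<xi> \<eta>"
    by (rule locally_isomorphicI[OF T(1,2)]) (rule T(3)[rule_format])
  then show ?thesis using \<xi> by blast
qed

end
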